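(* Let $\alpha$ be a twisted partial action of a group $G$ on a unital ring $R$ such that every ideal $D_g$ is generated by a central idempotent $1_g$. Suppose that the centralizer $C_{R*_{\alpha}^{w}G}(Z(R))$ of the center $Z(R)$ of $R$ in the partial crossed product $R*_{\alpha}^{w}G$ is a simple ring. Then $R*_{\alpha}^{w}G$ is simple if and only if $R$ is $\alpha$-simple.
   Context: $G$ is a group with identity $e$ and $R$ is an associative ring with identity $1_R$. A twisted partial action of $G$ on $R$ is a triple $\alpha=(\{D_g\}_{g\in G},\{\alpha_g\}_{g\in G},\{w_{g,h}\}_{(g,h)\in G\times G})$ where each $D_g$ is a two-sided ideal of $R$, $\alpha_g:D_{g^{-1}}\to D_g$ is a ring isomorphism, and $w_{g,h}$ is an invertible element of the multiplier ring of $D_gD_{gh}$, such that for all $g,h,t\in G$: (i) $D_g^2=D_g$ and $D_gD_h=D_hD_g$; (ii) $D_e=R$ and $\alpha_e=\mathrm{id}_R$; (iii) $\alpha_g(D_{g^{-1}}D_h)=D_gD_{gh}$; (iv) $\alpha_g\circ\alpha_h(a)=w_{g,h}\alpha_{gh}(a)w_{g,h}^{-1}$ for all $a\in D_{h^{-1}}D_{h^{-1}g^{-1}}$; (v) $w_{g,e}=w_{e,g}=1$ (the identity multiplier); (vi) $\alpha_g(aw_{h,t})w_{g,ht}=\alpha_g(a)w_{g,h}w_{gh,t}$ for all $a\in D_{g^{-1}}D_hD_{ht}$. Standing assumption: each $D_g$ is generated by an idempotent $1_g$ that is central in $R$. Hence $D_gD_{gh}$ is a unital ring with identity $1_g1_{gh}$,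 $w_{g,h}$ is identified with an invertible element of the ring $D_gD_{gh}$, and $w_{g,e}=w_{e,g}=1_g$. The partial crossed product $R*_{\alpha}^{w}G$ is $\bigoplus_{g\in G}D_g\delta_g$ (the $\delta_g$ are symbols) with the usual addition and multiplication $(a_g\delta_g)(b_h\delta_h)=\alpha_g(\alpha_g^{-1}(a_g)b_h)w_{g,h}\delta_{gh}$; it is an associative ring with identity $1_R\delta_e$, and $R$ is identified with $R\delta_e$. For a subset $Y$ of a ring $S$, $C_S(Y)=\{s\in S: sy=ys\ \forall y\in Y\}$. An ideal $I$ of $R$ is $\alpha$-invariant if $\alpha_g(I\cap D_{g^{-1}})\subseteq I\cap D_g$ for all $g\in G$. $R$ is $\alpha$-simple if its only $\alpha$-invariant (two-sided) ideals are the trivial ones, $\{0\}$ and $R$. *)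

theory Defs
  imports "HOL-Algebra.Algebra"
begin

locale simple_ring = ring +
  assumes nontrivial: "carrier R \<noteq> {\<zero>}"
    and ideal_trivial: "ideal I R \<Longrightarrow> I = {\<zero>} \<or> I = carrier R"

definition centralizer :: "('a, 'm) ring_scheme \<Rightarrow> 'a set \<Rightarrow> 'a set"
  where "centralizer S Y = {s \<in> carrier S. \<forall>y\<in>Y. s \<otimes>\<^bsub>S\<^esub> y = y \<otimes>\<^bsub>S\<^esub> s}"

definition center :: "('a, 'm) ring_scheme \<Rightarrow> 'a set"
  where "center R = centralizer R (carrier R)"

(* The ideal I of R as a ring in its own right, with identity u. *)
definition ideal_ring :: "('a, 'm) ring_scheme \<Rightarrow> 'a set \<Rightarrow> 'a \<Rightarrow> ('a, 'm) ring_scheme"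
  where "ideal_ring R I u = R\<lparr>carrier := I, one := u\<rparr>"

(* Twisted partial actions for which every D g is generated by a central idempotent u g.
   D g D(gh) then has the identity u g u(gh), so it equals its own multiplier ring, and
   w g h is taken to be an invertible element of D g D(gh) itself. Its inverse is the one in
   that ring; in general it is not invertible in R. *)
locale unital_twisted_partial_action = ring R + G: group G
  for R :: "('r, 'm) ring_scheme" and G :: "('g, 'n) monoid_scheme" +
  fixes D :: "'g \<Rightarrow> 'r set"
    and u :: "'g \<Rightarrow> 'r"
    and \<alpha> :: "'g \<Rightarrow> 'r \<Rightarrow> 'r"
    and w :: "'g \<Rightarrow> 'g \<Rightarrow> 'r"
  assumes D_ideal: "g \<in> carrier G \<Longrightarrow> ideal (D g) R"
    and u_central: "g \<in> carrier G \<Longrightarrow> u g \<in> center R"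
    and u_idem: "g \<in> carrier G \<Longrightarrow> u g \<otimes>\<^bsub>R\<^esub> u g = u g"
    and D_generated: "g \<in> carrier G \<Longrightarrow> D g = Idl\<^bsub>R\<^esub> {u g}"
    and \<alpha>_iso: "g \<in> carrier G \<Longrightarrow>
      \<alpha> g \<in> ring_iso (ideal_ring R (D (inv\<^bsub>G\<^esub> g)) (u (inv\<^bsub>G\<^esub> g))) (ideal_ring R (D g) (u g))"
    and w_unit: "\<lbrakk>g \<in> carrier G; h \<in> carrier G\<rbrakk> \<Longrightarrow>
      w g h \<in> Units (ideal_ring R (D g \<cdot>\<^bsub>R\<^esub> D (g \<otimes>\<^bsub>G\<^esub> h)) (u g \<otimes>\<^bsub>R\<^esub> u (g \<otimes>\<^bsub>G\<^esub> h)))"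
    and D_square: "g \<in> carrier G \<Longrightarrow> D g \<cdot>\<^bsub>R\<^esub> D g = D g"
    and D_commute: "\<lbrakk>g \<in> carrier G; h \<in> carrier G\<rbrakk> \<Longrightarrow> D g \<cdot>\<^bsub>R\<^esub> D h = D h \<cdot>\<^bsub>R\<^esub> D g"
    and D_one: "D \<one>\<^bsub>G\<^esub> = carrier R"
    and \<alpha>_one: "a \<in> carrier R \<Longrightarrow> \<alpha> \<one>\<^bsub>G\<^esub> a = a"
    and \<alpha>_image: "\<lbrakk>g \<in> carrier G; h \<in> carrier G\<rbrakk> \<Longrightarrow>
      \<alpha> g ` (D (inv\<^bsub>G\<^esub> g) \<cdot>\<^bsub>R\<^esub> D h) = D g \<cdot>\<^bsub>R\<^esub> D (g \<otimes>\<^bsub>G\<^esub> h)"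
    and \<alpha>_comp: "\<lbrakk>g \<in> carrier G; h \<in> carrier G;
        a \<in> D (inv\<^bsub>G\<^esub> h) \<cdot>\<^bsub>R\<^esub> D (inv\<^bsub>G\<^esub> h \<otimes>\<^bsub>G\<^esub> inv\<^bsub>G\<^esub> g)\<rbrakk> \<Longrightarrow>
      \<alpha> g (\<alpha> h a) = w g h \<otimes>\<^bsub>R\<^esub> \<alpha> (g \<otimes>\<^bsub>G\<^esub> h) a \<otimes>\<^bsub>R\<^esub>
        inv\<^bsub>ideal_ring R (D g \<cdot>\<^bsub>R\<^esub> D (g \<otimes>\<^bsub>G\<^esub> h)) (u g \<otimes>\<^bsub>R\<^esub> u (g \<otimes>\<^bsub>G\<^esub> h))\<^esub> (w g h)"
    and w_one_right: "g \<in> carrier G \<Longrightarrow> w g \<one>\<^bsub>G\<^esub> = u g"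
    and w_one_left: "g \<in> carrier G \<Longrightarrow> w \<one>\<^bsub>G\<^esub> g = u g"
    and w_cocycle: "\<lbrakk>g \<in> carrier G; h \<in> carrier G; t \<in> carrier G;
        a \<in> D (inv\<^bsub>G\<^esub> g) \<cdot>\<^bsub>R\<^esub> D h \<cdot>\<^bsub>R\<^esub> D (h \<otimes>\<^bsub>G\<^esub> t)\<rbrakk> \<Longrightarrow>
      \<alpha> g (a \<otimes>\<^bsub>R\<^esub> w h t) \<otimes>\<^bsub>R\<^esub> w g (h \<otimes>\<^bsub>G\<^esub> t) = \<alpha> g a \<otimes>\<^bsub>R\<^esub> w g h \<otimes>\<^bsub>R\<^esub> w (g \<otimes>\<^bsub>G\<^esub> h) t"

definition \<alpha>_invariant ::
  "('r, 'm) ring_scheme \<Rightarrow> ('g, 'n) monoid_scheme \<Rightarrow> ('g \<Rightarrow> 'r set) \<Rightarrow> ('g \<Rightarrow> 'r \<Rightarrow> 'r) \<Rightarrow> 'r set \<Rightarrow> bool"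
  where "\<alpha>_invariant R G D \<alpha> I \<longleftrightarrow>
    ideal I R \<and> (\<forall>g\<in>carrier G. \<alpha> g ` (I \<inter> D (inv\<^bsub>G\<^esub> g)) \<subseteq> I \<inter> D g)"

definition \<alpha>_simple ::
  "('r, 'm) ring_scheme \<Rightarrow> ('g, 'n) monoid_scheme \<Rightarrow> ('g \<Rightarrow> 'r set) \<Rightarrow> ('g \<Rightarrow> 'r \<Rightarrow> 'r) \<Rightarrow> bool"
  where "\<alpha>_simple R G D \<alpha> \<longleftrightarrow> (\<forall>I. \<alpha>_invariant R G D \<alpha> I \<longrightarrow> I = {\<zero>\<^bsub>R\<^esub>} \<or> I = carrier R)"

(* An element of the crossed product, i.e. a finite sum of a g \<delta> g with a g in D g, is
   represented by its coefficient function a on carrier G. *)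
definition monomial :: "('r, 'm) ring_scheme \<Rightarrow> ('g, 'n) monoid_scheme \<Rightarrow> 'g \<Rightarrow> 'r \<Rightarrow> 'g \<Rightarrow> 'r"
  where "monomial R G g a = (\<lambda>h\<in>carrier G. if h = g then a else \<zero>\<^bsub>R\<^esub>)"

definition supp :: "('r, 'm) ring_scheme \<Rightarrow> ('g, 'n) monoid_scheme \<Rightarrow> ('g \<Rightarrow> 'r) \<Rightarrow> 'g set"
  where "supp R G f = {g \<in> carrier G. f g \<noteq> \<zero>\<^bsub>R\<^esub>}"

(* The coefficient of (a g \<delta> g)(b h \<delta> h) at \<delta>(gh). *)
definition twisted_mult ::
  "('r, 'm) ring_scheme \<Rightarrow> ('g, 'n) monoid_scheme \<Rightarrow> ('g \<Rightarrow> 'r set) \<Rightarrow> ('g \<Rightarrow> 'r \<Rightarrow> 'r) \<Rightarrow>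
    ('g \<Rightarrow> 'g \<Rightarrow> 'r) \<Rightarrow> 'g \<Rightarrow> 'r \<Rightarrow> 'g \<Rightarrow> 'r \<Rightarrow> 'r"
  where "twisted_mult R G D \<alpha> w g a h b =
    \<alpha> g (inv_into (D (inv\<^bsub>G\<^esub> g)) (\<alpha> g) a \<otimes>\<^bsub>R\<^esub> b) \<otimes>\<^bsub>R\<^esub> w g h"

definition crossed_product ::
  "('r, 'm) ring_scheme \<Rightarrow> ('g, 'n) monoid_scheme \<Rightarrow> ('g \<Rightarrow> 'r set) \<Rightarrow> ('g \<Rightarrow> 'r \<Rightarrow> 'r) \<Rightarrow>
    ('g \<Rightarrow> 'g \<Rightarrow> 'r) \<Rightarrow> ('g \<Rightarrow> 'r) ring"
  where "crossed_product R G D \<alpha> w =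
    \<lparr>carrier = {f \<in> (\<Pi>\<^sub>E g\<in>carrier G. D g). finite (supp R G f)},
     monoid.mult = (\<lambda>f f'. \<lambda>k\<in>carrier G.
       finsum R (\<lambda>(g, h). twisted_mult R G D \<alpha> w g (f g) h (f' h))
         {(g, h) \<in> supp R G f \<times> supp R G f'. g \<otimes>\<^bsub>G\<^esub> h = k}),
     one = monomial R G \<one>\<^bsub>G\<^esub> \<one>\<^bsub>R\<^esub>,
     ring.zero = (\<lambda>g\<in>carrier G. \<zero>\<^bsub>R\<^esub>),
     ring.add = (\<lambda>f f'. \<lambda>g\<in>carrier G. f g \<oplus>\<^bsub>R\<^esub> f' g)\<rparr>"

end

theory Submission
  imports Defs
begin

text \<open>Take an element \<open>x\<close> of minimal support in a nonzero ideal of the crossed product. After right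
  multiplication by a monomial, \<open>\<one>\<close> lies in its support; commutators with central elements of \<open>R\<close>
  then have smaller support, so they vanish. Hence every nonzero ideal meets the centralizer of the
  center, and simplicity of the centralizer alone forces the crossed product to be simple.
  Conversely, the elements with all coefficients in an \<open>\<alpha>\<close>-invariant ideal of \<open>R\<close> form an ideal
  of the crossed product.\<close>

text \<open>The commutator of \<open>y\<close> with an element \<open>r\<close> of \<open>R\<close>
  has coefficient \<open>y k \<otimes> \<beta> k r \<ominus> r \<otimes> y k\<close> at
  \<open>k\<close>, so its support never grows. At the identity of \<open>G\<close> this is an
  ordinary commutator in \<open>R\<close>, which is sure to vanish only for central
  \<open>r\<close>. Hence the center of \<open>R\<close> is what gets centralized, and the support
  is first moved onto the identity. The move must not lose the coefficient: it becomes
  \<open>x g \<otimes> w g (inv g)\<close>, and although \<open>w g (inv g)\<close> need not be a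
  unit of \<open>R\<close>, it is one in \<open>D g\<close>, where \<open>x g\<close> lies. The main
  obstacle is the bookkeeping of domains. \<open>crossed_product\<close> is only a record, so its
  ring axioms must be derived from identities that hold on products of ideals. Membership in these
  ideals becomes an equation with the idempotents \<open>u g\<close>, and surplus idempotents are
  absorbed by a neighbouring \<open>w\<close>.\<close>

lemma (in ideal) finsum_closed_ideal:
  assumes "f \<in> A \<rightarrow> I"
  shows "finsum R f A \<in> I"
  using assms
proof (induct A rule: infinite_finite_induct)
  case (insert a A)
  then have "f \<in> A \<rightarrow> carrier R" "f a \<in> carrier R" "f a \<in> I" "f \<in> A \<rightarrow> I"
    using a_subset by (auto simp: Pi_def)
  with insert show ?case by simp
qed (simp_all add: zero_closed)

text \<open>Infinite index sets cause no trouble: a sum over such a set is zero by default, and then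
  both sides are zero.\<close>

lemma (in abelian_monoid) finsum_swap:
  assumes "\<And>i j. i \<in> A \<Longrightarrow> j \<in> B \<Longrightarrow> f i j \<in> carrier G"
  shows "finsum G (\<lambda>i. finsum G (f i) B) A = finsum G (\<lambda>j. finsum G (\<lambda>i. f i j) A) B"
  using assms
proof (induct A rule: infinite_finite_induct)
  case (insert a A)
  then have "finsum G (\<lambda>j. finsum G (\<lambda>i. f i j) (insert a A)) B
      = finsum G (\<lambda>j. f a j \<oplus> finsum G (\<lambda>i. f i j) A) B"
    by (intro finsum_cong') (auto intro!: finsum_insert finsum_closed)
  with insert show ?case by (simp add: finsum_addf Pi_def)
qed simp_all

locale unital_crossed_product = unital_twisted_partial_action R G D u \<alpha> w
  for R :: "('r, 'm) ring_scheme" (structure) and G :: "('g, 'n) monoid_scheme"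
    and D and u and \<alpha> and w
begin

section \<open>Central idempotents and the ideals they generate\<close>

lemma u_closed [simp]: "g \<in> carrier G \<Longrightarrow> u g \<in> carrier R"
  using u_central by (auto simp: center_def centralizer_def)

lemma u_comm: "\<lbrakk>g \<in> carrier G; x \<in> carrier R\<rbrakk> \<Longrightarrow> u g \<otimes> x = x \<otimes> u g"
  using u_central by (auto simp: center_def centralizer_def)

lemma u_left_comm:
  "\<lbrakk>g \<in> carrier G; x \<in> carrier R; y \<in> carrier R\<rbrakk> \<Longrightarrow> u g \<otimes> (x \<otimes> y) = x \<otimes> (u g \<otimes> y)"
  by (metis m_assoc u_comm u_closed)

lemma u_idem_left:
  "\<lbrakk>g \<in> carrier G; x \<in> carrier R\<rbrakk> \<Longrightarrow> u g \<otimes> (u g \<otimes> x) = u g \<otimes> x"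
  by (simp add: m_assoc[symmetric] u_idem)

text \<open>Between two idempotents commutation is a permutative rule, so ordered rewriting sorts
  products of them. The general \<open>u_comm\<close> would loop there and is used only for a fixed
  \<open>x\<close>.\<close>

lemma u_u_comm:
  "\<lbrakk>g \<in> carrier G; h \<in> carrier G\<rbrakk> \<Longrightarrow> u g \<otimes> u h = u h \<otimes> u g"
  by (rule u_comm) auto

lemma u_u_left_comm:
  "\<lbrakk>g \<in> carrier G; h \<in> carrier G; x \<in> carrier R\<rbrakk> \<Longrightarrow> u g \<otimes> (u h \<otimes> x) = u h \<otimes> (u g \<otimes> x)"
  by (rule u_left_comm) auto

lemmas u_ac = m_assoc u_idem u_idem_left u_u_comm u_u_left_comm

text \<open>The elements fixed by the central idempotent \<open>u g\<close> form an ideal containing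
  \<open>u g\<close>, hence contain \<open>Idl {u g}\<close>. Conversely, a fixed element is a
  multiple of \<open>u g\<close>. This replaces ideal membership by an equation everywhere
  below.\<close>

lemma D_iff:
  assumes g: "g \<in> carrier G"
  shows "x \<in> D g \<longleftrightarrow> x \<in> carrier R \<and> x \<otimes> u g = x"
proof -
  interpret I: ideal "D g" R using D_ideal[OF g] .
  let ?E = "{x \<in> carrier R. x \<otimes> u g = x}"
  have "ideal ?E R"
  proof (rule idealI)
    show "ring R" by (rule ring_axioms)
    show "subgroup ?E (add_monoid R)"
    proof (rule add.subgroupI)
      show "?E \<noteq> {}" using g l_null[of "u g"] by fastforce
    qed (use g in \<open>auto simp: l_distr l_minus\<close>)
    show "x \<otimes> a \<in> ?E" if "a \<in> ?E" "x \<in> carrier R" for a x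
      using that g by (simp add: m_assoc)
    show "a \<otimes> x \<in> ?E" if "a \<in> ?E" "x \<in> carrier R" for a x
      using that g by (simp add: m_assoc u_comm[of g x, symmetric]) (simp add: m_assoc[symmetric])
  qed
  moreover have "{u g} \<subseteq> ?E"
    using g u_idem[OF g] by simp
  ultimately have "Idl {u g} \<subseteq> ?E"
    by (rule genideal_minimal)
  then have sub: "D g \<subseteq> ?E"
    using D_generated[OF g] by simp
  have "u g \<in> D g"
    using genideal_self'[OF u_closed[OF g]] D_generated[OF g] by simp
  then have "x \<in> carrier R \<Longrightarrow> x \<otimes> u g \<in> D g"
    by (rule I.I_l_closed)
  with sub show ?thesis by auto
qed

text \<open>The product ideal is the intersection: if \<open>x\<close> lies in both ideals, then
  \<open>x = x \<otimes> u h\<close> is itself a product.\<close>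

lemma D_prod_iff:
  assumes g: "g \<in> carrier G" and h: "h \<in> carrier G"
  shows "x \<in> D g \<cdot> D h \<longleftrightarrow> x \<in> carrier R \<and> x \<otimes> u g = x \<and> x \<otimes> u h = x"
proof
  assume "x \<in> D g \<cdot> D h"
  then have "x \<in> D g \<inter> D h" using ideal_prod_inter D_ideal g h by blast
  then show "x \<in> carrier R \<and> x \<otimes> u g = x \<and> x \<otimes> u h = x" using D_iff g h by auto
next
  assume x: "x \<in> carrier R \<and> x \<otimes> u g = x \<and> x \<otimes> u h = x"
  then have "x \<in> D g" "u h \<in> D h" using D_iff g h u_idem by auto
  then have "x \<otimes> u h \<in> D g \<cdot> D h" by (rule ideal_prod.prod)
  with x show "x \<in> D g \<cdot> D h" by simp
qed

lemma D_closed: "\<lbrakk>g \<in> carrier G; x \<in> D g\<rbrakk> \<Longrightarrow> x \<in> carrier R"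
  by (simp add: D_iff)

lemma u_in_D: "g \<in> carrier G \<Longrightarrow> u g \<in> D g"
  by (simp add: D_iff u_idem)

lemma u_mult_in_D: "\<lbrakk>g \<in> carrier G; x \<in> carrier R\<rbrakk> \<Longrightarrow> u g \<otimes> x \<in> D g"
  by (simp add: D_iff u_comm[of _ x] u_ac)

lemma D_absorb_left: "\<lbrakk>g \<in> carrier G; x \<in> D g\<rbrakk> \<Longrightarrow> u g \<otimes> x = x"
  by (simp add: D_iff u_comm[of _ x])

lemma u_one: "u \<one>\<^bsub>G\<^esub> = \<one>"
  using D_iff[of "\<one>\<^bsub>G\<^esub>" \<one>] by (simp add: D_one)

section \<open>The twisting units and their inverses in \<open>D g D(gh)\<close>\<close>

text \<open>Makes the library facts on units available for \<open>w g h\<close>, which is invertible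
  only relative to the identity \<open>u g \<otimes> u (gh)\<close>.\<close>

lemma monoid_ideal_ring:
  assumes g: "g \<in> carrier G" and h: "h \<in> carrier G"
  shows "monoid (ideal_ring R (D g \<cdot> D h) (u g \<otimes> u h))"
proof -
  have c: "x \<otimes> (y \<otimes> u k) = (x \<otimes> y) \<otimes> u k"
    if "x \<in> carrier R" "y \<in> carrier R" "k \<in> carrier G" for x y k
    using that by (simp add: m_assoc)
  show ?thesis
    unfolding ideal_ring_def
  proof (rule monoidI, goal_cases)
    case (1 x y) then show ?case using g h by (auto simp: D_prod_iff m_assoc)
  next
    case 2 then show ?case
      using g h by (simp add: D_prod_iff u_ac)
  next
    case (3 x y z) then show ?case using g h by (auto simp: D_prod_iff m_assoc)
  next
    case (4 x) then show ?case using g h by (auto simp: D_prod_iff m_assoc u_comm[of _ x])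
  next
    case (5 x) then show ?case using g h by (auto simp: D_prod_iff c)
  qed
qed

lemma w_in_D:
  assumes g: "g \<in> carrier G" and h: "h \<in> carrier G"
  shows "w g h \<in> carrier R" "w g h \<otimes> u g = w g h" "w g h \<otimes> u (g \<otimes>\<^bsub>G\<^esub> h) = w g h"
    "u g \<otimes> w g h = w g h" "u (g \<otimes>\<^bsub>G\<^esub> h) \<otimes> w g h = w g h"
proof -
  have "w g h \<in> D g \<cdot> D (g \<otimes>\<^bsub>G\<^esub> h)"
    using w_unit[OF g h] by (simp add: Units_def ideal_ring_def)
  then show *: "w g h \<in> carrier R" "w g h \<otimes> u g = w g h" "w g h \<otimes> u (g \<otimes>\<^bsub>G\<^esub> h) = w g h"
    using g h by (simp_all add: D_prod_iff)
  with g h show "u g \<otimes> w g h = w g h" "u (g \<otimes>\<^bsub>G\<^esub> h) \<otimes> w g h = w g h"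
    by (simp_all add: u_comm[of _ "w g h"])
qed

lemmas w_closed [simp] = w_in_D(1)

abbreviation w_inv :: "'g \<Rightarrow> 'g \<Rightarrow> 'r"
  where "w_inv g h \<equiv>
    inv\<^bsub>ideal_ring R (D g \<cdot> D (g \<otimes>\<^bsub>G\<^esub> h)) (u g \<otimes> u (g \<otimes>\<^bsub>G\<^esub> h))\<^esub> (w g h)"

text \<open>Cancelling \<open>w g h\<close> leaves an idempotent rather than \<open>\<one>\<close>;
  every later use has a factor nearby that absorbs it.\<close>

lemma w_inv:
  assumes g: "g \<in> carrier G" and h: "h \<in> carrier G"
  shows "w_inv g h \<in> carrier R"
    "w_inv g h \<otimes> w g h = u g \<otimes> u (g \<otimes>\<^bsub>G\<^esub> h)" "w g h \<otimes> w_inv g h = u g \<otimes> u (g \<otimes>\<^bsub>G\<^esub> h)"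
proof -
  interpret E: monoid "ideal_ring R (D g \<cdot> D (g \<otimes>\<^bsub>G\<^esub> h)) (u g \<otimes> u (g \<otimes>\<^bsub>G\<^esub> h))"
    using monoid_ideal_ring g h by simp
  show "w_inv g h \<in> carrier R"
    using E.Units_inv_closed[OF w_unit[OF g h]] g h by (simp add: ideal_ring_def D_prod_iff)
  show "w_inv g h \<otimes> w g h = u g \<otimes> u (g \<otimes>\<^bsub>G\<^esub> h)" "w g h \<otimes> w_inv g h = u g \<otimes> u (g \<otimes>\<^bsub>G\<^esub> h)"
    using E.Units_l_inv[OF w_unit[OF g h]] E.Units_r_inv[OF w_unit[OF g h]]
    by (simp_all add: ideal_ring_def)
qed

section \<open>The isomorphisms \<alpha> and their total extensions \<beta>\<close>

lemma \<alpha>_hom: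
  assumes g: "g \<in> carrier G"
  shows "x \<in> D (inv\<^bsub>G\<^esub> g) \<Longrightarrow> \<alpha> g x \<in> D g"
    "\<lbrakk>x \<in> D (inv\<^bsub>G\<^esub> g); y \<in> D (inv\<^bsub>G\<^esub> g)\<rbrakk> \<Longrightarrow> \<alpha> g (x \<otimes> y) = \<alpha> g x \<otimes> \<alpha> g y"
    "\<lbrakk>x \<in> D (inv\<^bsub>G\<^esub> g); y \<in> D (inv\<^bsub>G\<^esub> g)\<rbrakk> \<Longrightarrow> \<alpha> g (x \<oplus> y) = \<alpha> g x \<oplus> \<alpha> g y"
    "\<alpha> g (u (inv\<^bsub>G\<^esub> g)) = u g"
    "bij_betw (\<alpha> g) (D (inv\<^bsub>G\<^esub> g)) (D g)"
  using ring_iso_memE[OF \<alpha>_iso[OF g]] by (auto simp: ideal_ring_def)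

text \<open>The extension of \<open>\<alpha> g\<close> to all of \<open>R\<close> that kills the complementary summand of
  \<open>D (inv g)\<close>. It lets the relations among \<open>\<alpha>\<close> and \<open>w\<close> be stated without domain conditions.\<close>

definition \<beta> :: "'g \<Rightarrow> 'r \<Rightarrow> 'r"
  where "\<beta> g x = \<alpha> g (u (inv\<^bsub>G\<^esub> g) \<otimes> x)"

lemma \<beta>_in_D: "\<lbrakk>g \<in> carrier G; x \<in> carrier R\<rbrakk> \<Longrightarrow> \<beta> g x \<in> D g"
  by (simp add: \<beta>_def \<alpha>_hom u_mult_in_D)

lemma \<beta>_closed [simp]: "\<lbrakk>g \<in> carrier G; x \<in> carrier R\<rbrakk> \<Longrightarrow> \<beta> g x \<in> carrier R"
  using \<beta>_in_D D_closed by blast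

lemma \<beta>_eq_\<alpha>: "\<lbrakk>g \<in> carrier G; x \<in> D (inv\<^bsub>G\<^esub> g)\<rbrakk> \<Longrightarrow> \<beta> g x = \<alpha> g x"
  by (simp add: \<beta>_def D_absorb_left)

lemma \<beta>_add:
  "\<lbrakk>g \<in> carrier G; x \<in> carrier R; y \<in> carrier R\<rbrakk> \<Longrightarrow> \<beta> g (x \<oplus> y) = \<beta> g x \<oplus> \<beta> g y"
  by (simp add: \<beta>_def r_distr \<alpha>_hom u_mult_in_D)

text \<open>Multiplication by a central idempotent is multiplicative, and \<open>\<beta> g\<close>
  is such a projection followed by \<open>\<alpha> g\<close>.\<close>

lemma \<beta>_mult:
  assumes "g \<in> carrier G" "x \<in> carrier R" "y \<in> carrier R"
  shows "\<beta> g (x \<otimes> y) = \<beta> g x \<otimes> \<beta> g y"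
proof -
  let ?e = "u (inv\<^bsub>G\<^esub> g)"
  have "?e \<otimes> x \<otimes> (?e \<otimes> y) = ?e \<otimes> (x \<otimes> y)"
    using assms by (simp add: u_ac u_comm[of _ x] u_left_comm[of _ x])
  then show ?thesis
    using assms by (simp add: \<beta>_def \<alpha>_hom(2)[symmetric] u_mult_in_D)
qed

lemma \<beta>_zero [simp]:
  assumes g: "g \<in> carrier G"
  shows "\<beta> g \<zero> = \<zero>"
proof -
  have "\<beta> g \<zero> \<oplus> \<beta> g \<zero> = \<beta> g \<zero>"
    using \<beta>_add[OF g, of \<zero> \<zero>] by simp
  then show ?thesis
    using g by (metis \<beta>_closed add.r_cancel_one zero_closed)
qed

lemma \<beta>_finsum:
  assumes g: "g \<in> carrier G" and "f \<in> A \<rightarrow> carrier R"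
  shows "\<beta> g (finsum R f A) = finsum R (\<lambda>i. \<beta> g (f i)) A"
  using assms(2)
  by (induct A rule: infinite_finite_induct) (use g in \<open>simp_all add: \<beta>_add Pi_def\<close>)

lemma \<beta>_one: "g \<in> carrier G \<Longrightarrow> \<beta> g \<one> = u g"
  by (simp add: \<beta>_def \<alpha>_hom)

lemma \<beta>_group_one [simp]: "x \<in> carrier R \<Longrightarrow> \<beta> \<one>\<^bsub>G\<^esub> x = x"
  by (simp add: \<beta>_def \<alpha>_one u_one)

text \<open>By \<open>\<alpha>_image\<close>, \<open>\<alpha> g\<close> maps
  \<open>D (inv g) D h\<close> onto \<open>D g D(gh)\<close>, and a surjective multiplicative map
  sends the identity \<open>?e\<close> to the identity \<open>?f\<close>: if \<open>a\<close> is a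
  preimage of \<open>?f\<close>, then \<open>a \<otimes> ?e = a\<close> becomes
  \<open>?f \<otimes> \<alpha> g ?e = ?f\<close>.\<close>

lemma \<beta>_u:
  assumes g: "g \<in> carrier G" and h: "h \<in> carrier G"
  shows "\<beta> g (u h) = u g \<otimes> u (g \<otimes>\<^bsub>G\<^esub> h)"
proof -
  let ?e = "u (inv\<^bsub>G\<^esub> g) \<otimes> u h" and ?f = "u g \<otimes> u (g \<otimes>\<^bsub>G\<^esub> h)"
  interpret E: monoid "ideal_ring R (D (inv\<^bsub>G\<^esub> g) \<cdot> D h) ?e"
    using monoid_ideal_ring g h by simp
  interpret F: monoid "ideal_ring R (D g \<cdot> D (g \<otimes>\<^bsub>G\<^esub> h)) ?f"
    using monoid_ideal_ring g h by simp
  have e: "?e \<in> D (inv\<^bsub>G\<^esub> g) \<cdot> D h" and f: "?f \<in> D g \<cdot> D (g \<otimes>\<^bsub>G\<^esub> h)"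
    using E.one_closed F.one_closed by (simp_all add: ideal_ring_def)
  obtain a where a: "a \<in> D (inv\<^bsub>G\<^esub> g) \<cdot> D h" "\<alpha> g a = ?f"
    using f \<alpha>_image[OF g h] by (metis imageE)
  have "\<alpha> g ?e \<in> D g \<cdot> D (g \<otimes>\<^bsub>G\<^esub> h)"
    using e \<alpha>_image[OF g h] by blast
  then have 1: "?f \<otimes> \<alpha> g ?e = \<alpha> g ?e"
    using F.l_one by (simp add: ideal_ring_def)
  have "a \<otimes> ?e = a" using E.r_one a by (simp add: ideal_ring_def)
  moreover have "a \<in> D (inv\<^bsub>G\<^esub> g)" "?e \<in> D (inv\<^bsub>G\<^esub> g)"
    using a e g h by (simp_all add: D_prod_iff D_iff)
  ultimately have "?f \<otimes> \<alpha> g ?e = ?f" using a \<alpha>_hom(2)[OF g, of a ?e] by simp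
  with 1 show ?thesis by (simp add: \<beta>_def)
qed

text \<open>The composition law with the inverse of \<open>w g h\<close> moved to the other side. It
  holds for every \<open>x\<close> because both sides depend only on the component of
  \<open>x\<close> in the ideal where \<open>\<alpha>_comp\<close> applies.\<close>

lemma \<beta>_comp:
  assumes g: "g \<in> carrier G" and h: "h \<in> carrier G" and x: "x \<in> carrier R"
  shows "\<beta> g (\<beta> h x) \<otimes> w g h = w g h \<otimes> \<beta> (g \<otimes>\<^bsub>G\<^esub> h) x"
proof -
  let ?gh = "g \<otimes>\<^bsub>G\<^esub> h"
  \<comment> \<open>The component of \<open>x\<close> in \<open>D (inv h) D(inv (gh))\<close>, the
    domain of \<open>\<alpha>_comp\<close>.\<close>
  let ?a = "u (inv\<^bsub>G\<^esub> h) \<otimes> (u (inv\<^bsub>G\<^esub> ?gh) \<otimes> x)"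
  note [simp] = g h x G.inv_mult_group
  have hinv: "h \<otimes>\<^bsub>G\<^esub> (inv\<^bsub>G\<^esub> h \<otimes>\<^bsub>G\<^esub> inv\<^bsub>G\<^esub> g) = inv\<^bsub>G\<^esub> g"
    by (simp add: G.m_assoc[symmetric])
  have ghinv: "?gh \<otimes>\<^bsub>G\<^esub> inv\<^bsub>G\<^esub> h = g"
    by (simp add: G.m_assoc)
  have aD: "?a \<in> D (inv\<^bsub>G\<^esub> h)" by (simp add: u_mult_in_D)
  have "?a \<otimes> u (inv\<^bsub>G\<^esub> ?gh) = ?a"
    by (simp add: u_ac u_comm[of _ x])
  with aD have a: "?a \<in> D (inv\<^bsub>G\<^esub> h) \<cdot> D (inv\<^bsub>G\<^esub> h \<otimes>\<^bsub>G\<^esub> inv\<^bsub>G\<^esub> g)"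
    by (simp add: D_prod_iff D_iff)
  \<comment> \<open>Cutting by \<open>u (inv (gh))\<close> before \<open>\<beta> h\<close> amounts
    to cutting by \<open>u (inv g)\<close> after it, and \<open>\<beta> g\<close> performs the
    latter cut anyway.\<close>
  have "\<alpha> h ?a = \<beta> h (u (inv\<^bsub>G\<^esub> ?gh) \<otimes> x)"
    by (simp add: \<beta>_def)
  also have "\<dots> = u h \<otimes> u (inv\<^bsub>G\<^esub> g) \<otimes> \<beta> h x"
    by (simp add: \<beta>_mult \<beta>_u hinv del: G.inv_mult_group) (simp add: \<beta>_u hinv)
  also have "\<dots> = u (inv\<^bsub>G\<^esub> g) \<otimes> \<beta> h x"
    using D_absorb_left[OF h \<beta>_in_D[OF h x]]
    by (simp add: m_assoc u_left_comm[of h "u (inv\<^bsub>G\<^esub> g)"] del: G.inv_mult_group)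
  finally have "\<beta> g (\<beta> h x) = \<alpha> g (\<alpha> h ?a)" by (simp add: \<beta>_def)
  also have "\<dots> = w g h \<otimes> \<alpha> ?gh ?a \<otimes> w_inv g h"
    using \<alpha>_comp[OF g h a] .
  also have "\<alpha> ?gh ?a = \<beta> ?gh (u (inv\<^bsub>G\<^esub> h) \<otimes> x)"
    by (simp add: \<beta>_def u_u_left_comm)
  also have "\<dots> = u ?gh \<otimes> u g \<otimes> \<beta> ?gh x"
    by (simp add: \<beta>_mult \<beta>_u ghinv)
  also have "w g h \<otimes> (u ?gh \<otimes> u g \<otimes> \<beta> ?gh x) = w g h \<otimes> \<beta> ?gh x"
    by (simp add: m_assoc[symmetric] w_in_D)
  finally have "\<beta> g (\<beta> h x) \<otimes> w g h = w g h \<otimes> \<beta> ?gh x \<otimes> (u g \<otimes> u ?gh)"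
    by (simp add: m_assoc w_inv w_in_D)
  \<comment> \<open>The idempotents left over from the inverse are central, so they move back to
    \<open>w g h\<close>, which absorbs them.\<close>
  also have "\<dots> = (w g h \<otimes> u ?gh \<otimes> u g) \<otimes> \<beta> ?gh x"
    by (simp add: m_assoc u_comm[of _ "\<beta> ?gh x"] u_left_comm[of _ "\<beta> ?gh x"] u_u_comm)
  finally show ?thesis by (simp add: w_in_D)
qed

text \<open>On the left \<open>w h t\<close> already contains the idempotents that cut
  \<open>x\<close> down to the domain of \<open>w_cocycle\<close>; on the right the idempotents
  arising from that cut are absorbed by \<open>w g h\<close> and \<open>w (gh) t\<close>.\<close>

lemma \<beta>_cocycle:
  assumes g: "g \<in> carrier G" and h: "h \<in> carrier G" and t: "t \<in> carrier G" and x: "x \<in> carrier R"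
  shows "\<beta> g (x \<otimes> w h t) \<otimes> w g (h \<otimes>\<^bsub>G\<^esub> t) = \<beta> g x \<otimes> w g h \<otimes> w (g \<otimes>\<^bsub>G\<^esub> h) t"
proof -
  let ?gh = "g \<otimes>\<^bsub>G\<^esub> h" and ?ht = "h \<otimes>\<^bsub>G\<^esub> t"
  let ?ght = "g \<otimes>\<^bsub>G\<^esub> (h \<otimes>\<^bsub>G\<^esub> t)"
  let ?y = "x \<otimes> (u h \<otimes> u ?ht)"
  let ?a = "u (inv\<^bsub>G\<^esub> g) \<otimes> ?y"
  note [simp] = g h t x
  have "?a \<otimes> u h = ?a" "?a \<otimes> u ?ht = ?a" "?a \<otimes> u (inv\<^bsub>G\<^esub> g) = ?a"
    by (simp_all add: u_ac u_comm[of _ x] u_left_comm[of _ x])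
  then have a1: "?a \<in> D (inv\<^bsub>G\<^esub> g) \<cdot> D h" and a2: "?a \<otimes> u ?ht = ?a"
    by (simp_all add: D_prod_iff)
  \<comment> \<open>The extra factor \<open>u ?ht\<close> exhibits \<open>?a\<close> as an element
    of the triple product of ideals.\<close>
  have "?a \<otimes> u ?ht \<in> D (inv\<^bsub>G\<^esub> g) \<cdot> D h \<cdot> D ?ht"
    using a1 by (rule ideal_prod.prod) (simp add: u_in_D)
  then have a: "?a \<in> D (inv\<^bsub>G\<^esub> g) \<cdot> D h \<cdot> D ?ht"
    by (simp only: a2)
  have "u (inv\<^bsub>G\<^esub> g) \<otimes> (x \<otimes> w h t) = ?a \<otimes> w h t"
    by (simp add: m_assoc w_in_D)
  then have "\<beta> g (x \<otimes> w h t) \<otimes> w g ?ht = \<beta> g ?y \<otimes> w g h \<otimes> w ?gh t"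
    using w_cocycle[OF g h t a] by (simp add: \<beta>_def)
  also have "\<beta> g ?y = \<beta> g x \<otimes> (u g \<otimes> u ?gh \<otimes> (u g \<otimes> u ?ght))"
    by (simp add: \<beta>_mult \<beta>_u)
  also have "\<dots> \<otimes> w g h = \<beta> g x \<otimes> (u ?ght \<otimes> w g h)"
    by (simp add: m_assoc w_in_D u_left_comm[of _ "u ?ght"])
  also have "\<dots> \<otimes> w ?gh t = \<beta> g x \<otimes> w g h \<otimes> (u ?ght \<otimes> w ?gh t)"
    by (simp add: m_assoc u_left_comm[of _ "w g h"])
  also have "u ?ght \<otimes> w ?gh t = w ?gh t"
    using w_in_D(5)[of ?gh t] by (simp add: G.m_assoc)
  finally show ?thesis .
qed

section \<open>Products of homogeneous elements\<close>

text \<open>A form of \<open>twisted_mult\<close> free of the inverse of \<open>\<alpha> g\<close>: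
  if \<open>a = \<beta> g c\<close>, then
  \<open>\<beta> g (c \<otimes> b) = a \<otimes> \<beta> g b\<close>. It is total and biadditive on
  \<open>R\<close>.\<close>

definition hmult :: "'g \<Rightarrow> 'r \<Rightarrow> 'g \<Rightarrow> 'r \<Rightarrow> 'r"
  where "hmult g a h b = a \<otimes> \<beta> g b \<otimes> w g h"

lemma twisted_mult_eq:
  assumes g: "g \<in> carrier G" and h: "h \<in> carrier G" and a: "a \<in> D g" and b: "b \<in> carrier R"
  shows "twisted_mult R G D \<alpha> w g a h b = hmult g a h b"
proof -
  let ?c = "inv_into (D (inv\<^bsub>G\<^esub> g)) (\<alpha> g) a"
  have c: "?c \<in> D (inv\<^bsub>G\<^esub> g)" "\<alpha> g ?c = a"
    using \<alpha>_hom(5)[OF g] a by (auto simp: bij_betw_def inv_into_into f_inv_into_f)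
  then have "?c \<in> carrier R" "\<beta> g ?c = a"
    using g D_closed[of "inv\<^bsub>G\<^esub> g"] by (auto simp: \<beta>_eq_\<alpha>)
  moreover have "?c \<otimes> b \<in> D (inv\<^bsub>G\<^esub> g)"
    using c(1) g b D_ideal ideal.I_r_closed by (metis G.inv_closed)
  ultimately show ?thesis
    using g b by (simp add: twisted_mult_def hmult_def \<beta>_eq_\<alpha>[symmetric] \<beta>_mult)
qed

lemma hmult_closed [simp]:
  "\<lbrakk>g \<in> carrier G; h \<in> carrier G; a \<in> carrier R; b \<in> carrier R\<rbrakk> \<Longrightarrow> hmult g a h b \<in> carrier R"
  by (simp add: hmult_def w_in_D)

lemma hmult_in_D:
  "\<lbrakk>g \<in> carrier G; h \<in> carrier G; a \<in> carrier R; b \<in> carrier R\<rbrakk> \<Longrightarrow> hmult g a h b \<in> D (g \<otimes>\<^bsub>G\<^esub> h)"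
  by (simp add: hmult_def D_iff w_in_D m_assoc)

lemma hmult_zero [simp]:
  "\<lbrakk>g \<in> carrier G; h \<in> carrier G; b \<in> carrier R\<rbrakk> \<Longrightarrow> hmult g \<zero> h b = \<zero>"
  "\<lbrakk>g \<in> carrier G; h \<in> carrier G; a \<in> carrier R\<rbrakk> \<Longrightarrow> hmult g a h \<zero> = \<zero>"
  by (simp_all add: hmult_def w_in_D)

lemma hmult_distr:
  assumes "g \<in> carrier G" "h \<in> carrier G" "a \<in> carrier R" "b \<in> carrier R" "c \<in> carrier R"
  shows "hmult g (a \<oplus> b) h c = hmult g a h c \<oplus> hmult g b h c"
    "hmult g a h (b \<oplus> c) = hmult g a h b \<oplus> hmult g a h c"
  using assms by (simp_all add: hmult_def w_in_D \<beta>_add l_distr r_distr)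

lemma hmult_finsum:
  assumes "finite A" "g \<in> carrier G" "h \<in> carrier G" "a \<in> carrier R" "f \<in> A \<rightarrow> carrier R"
  shows "hmult g (finsum R f A) h a = finsum R (\<lambda>i. hmult g (f i) h a) A"
    "hmult g a h (finsum R f A) = finsum R (\<lambda>i. hmult g a h (f i)) A"
proof -
  have "(\<lambda>i. f i \<otimes> \<beta> g a) \<in> A \<rightarrow> carrier R" "(\<lambda>i. \<beta> g (f i)) \<in> A \<rightarrow> carrier R"
    "(\<lambda>i. a \<otimes> \<beta> g (f i)) \<in> A \<rightarrow> carrier R"
    using assms by (auto simp: Pi_def)
  then show "hmult g (finsum R f A) h a = finsum R (\<lambda>i. hmult g (f i) h a) A"
    "hmult g a h (finsum R f A) = finsum R (\<lambda>i. hmult g a h (f i)) A"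
    using assms by (simp_all add: hmult_def w_in_D \<beta>_finsum finsum_ldistr finsum_rdistr)
qed

text \<open>\<open>\<beta>_cocycle\<close> takes \<open>w h t\<close> out of
  \<open>\<beta> g\<close>, after which \<open>\<beta>_comp\<close> trades
  \<open>\<beta> g (\<beta> h c)\<close> for \<open>\<beta> (gh) c\<close> on the other side of
  \<open>w g h\<close>.\<close>

lemma hmult_assoc:
  assumes g: "g \<in> carrier G" and h: "h \<in> carrier G" and t: "t \<in> carrier G"
    and a: "a \<in> carrier R" and b: "b \<in> carrier R" and c: "c \<in> carrier R"
  shows "hmult (g \<otimes>\<^bsub>G\<^esub> h) (hmult g a h b) t c = hmult g a (h \<otimes>\<^bsub>G\<^esub> t) (hmult h b t c)"
proof -
  note [simp] = assms w_in_D
  have "hmult g a (h \<otimes>\<^bsub>G\<^esub> t) (hmult h b t c)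
      = a \<otimes> (\<beta> g (b \<otimes> \<beta> h c \<otimes> w h t) \<otimes> w g (h \<otimes>\<^bsub>G\<^esub> t))"
    by (simp add: hmult_def m_assoc)
  also have "\<dots> = a \<otimes> (\<beta> g b \<otimes> (\<beta> g (\<beta> h c) \<otimes> w g h) \<otimes> w (g \<otimes>\<^bsub>G\<^esub> h) t)"
    by (simp add: \<beta>_cocycle) (simp add: \<beta>_mult m_assoc)
  also have "\<dots> = hmult (g \<otimes>\<^bsub>G\<^esub> h) (hmult g a h b) t c"
    by (simp add: \<beta>_comp) (simp add: hmult_def m_assoc)
  finally show ?thesis by simp
qed

section \<open>The crossed product as a set of coefficient functions\<close>

abbreviation S :: "('g \<Rightarrow> 'r) ring"
  where "S \<equiv> crossed_product R G D \<alpha> w"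

lemma S_carrier_iff:
  "f \<in> carrier S \<longleftrightarrow> f \<in> (\<Pi>\<^sub>E g\<in>carrier G. D g) \<and> finite (supp R G f)"
  by (simp add: crossed_product_def)

lemma S_one: "\<one>\<^bsub>S\<^esub> = monomial R G \<one>\<^bsub>G\<^esub> \<one>"
  by (simp add: crossed_product_def)

lemma S_zero_apply [simp]: "g \<in> carrier G \<Longrightarrow> \<zero>\<^bsub>S\<^esub> g = \<zero>"
  by (simp add: crossed_product_def)

lemma S_add_apply [simp]: "g \<in> carrier G \<Longrightarrow> (f \<oplus>\<^bsub>S\<^esub> f') g = f g \<oplus> f' g"
  by (simp add: crossed_product_def)

lemma S_apply_in_D: "\<lbrakk>f \<in> carrier S; g \<in> carrier G\<rbrakk> \<Longrightarrow> f g \<in> D g"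
  by (auto simp: S_carrier_iff)

lemma S_apply_closed [simp]: "\<lbrakk>f \<in> carrier S; g \<in> carrier G\<rbrakk> \<Longrightarrow> f g \<in> carrier R"
  using S_apply_in_D D_closed by blast

lemma S_eqI:
  "\<lbrakk>f \<in> carrier S; f' \<in> carrier S; \<And>g. g \<in> carrier G \<Longrightarrow> f g = f' g\<rbrakk> \<Longrightarrow> f = f'"
  unfolding S_carrier_iff by (blast intro: PiE_ext)

lemma supp_finite: "f \<in> carrier S \<Longrightarrow> finite (supp R G f)"
  by (simp add: S_carrier_iff)

lemma zero_in_D: "g \<in> carrier G \<Longrightarrow> \<zero> \<in> D g"
  by (simp add: D_iff)

lemma S_zero_closed: "\<zero>\<^bsub>S\<^esub> \<in> carrier S"
proof -
  have "supp R G \<zero>\<^bsub>S\<^esub> = {}" by (auto simp: supp_def)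
  moreover have "\<zero>\<^bsub>S\<^esub> \<in> (\<Pi>\<^sub>E g\<in>carrier G. D g)"
    by (auto simp: PiE_iff zero_in_D) (simp add: crossed_product_def)
  ultimately show ?thesis by (simp add: S_carrier_iff)
qed

lemma supp_empty_iff: "f \<in> carrier S \<Longrightarrow> supp R G f = {} \<longleftrightarrow> f = \<zero>\<^bsub>S\<^esub>"
  by (auto simp: supp_def intro!: S_eqI S_zero_closed)

lemma supp_S_mult:
  "supp R G (f \<otimes>\<^bsub>S\<^esub> f') \<subseteq> (\<lambda>(g, h). g \<otimes>\<^bsub>G\<^esub> h) ` (supp R G f \<times> supp R G f')"
proof (rule subsetI, rule ccontr)
  fix k assume k: "k \<in> supp R G (f \<otimes>\<^bsub>S\<^esub> f')"
    and "k \<notin> (\<lambda>(g, h). g \<otimes>\<^bsub>G\<^esub> h) ` (supp R G f \<times> supp R G f')"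
  then have P: "{(g, h) \<in> supp R G f \<times> supp R G f'. g \<otimes>\<^bsub>G\<^esub> h = k} = {}" by auto
  have "(f \<otimes>\<^bsub>S\<^esub> f') k = finsum R (\<lambda>(g, h). twisted_mult R G D \<alpha> w g (f g) h (f' h))
    {(g, h) \<in> supp R G f \<times> supp R G f'. g \<otimes>\<^bsub>G\<^esub> h = k}"
    using k by (simp add: crossed_product_def supp_def)
  also have "\<dots> = \<zero>" by (simp only: P finsum_empty)
  finally show False using k by (simp add: supp_def)
qed

text \<open>Convolution indexed by the left factor alone, as \<open>gh = k\<close> determines
  \<open>h\<close>. The set \<open>A\<close> may exceed the support, the extra terms being zero, so
  that several products can be summed over one common index set.\<close>

lemma S_mult_apply:
  assumes f: "f \<in> carrier S" and f': "f' \<in> carrier S" and k: "k \<in> carrier G"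
    and A: "finite A" "supp R G f \<subseteq> A" "A \<subseteq> carrier G"
  shows "(f \<otimes>\<^bsub>S\<^esub> f') k
    = (\<Oplus>g\<in>A. hmult g (f g) (inv\<^bsub>G\<^esub> g \<otimes>\<^bsub>G\<^esub> k) (f' (inv\<^bsub>G\<^esub> g \<otimes>\<^bsub>G\<^esub> k)))"
proof -
  let ?q = "\<lambda>g. inv\<^bsub>G\<^esub> g \<otimes>\<^bsub>G\<^esub> k"
  let ?B = "{g \<in> supp R G f. ?q g \<in> supp R G f'}"
  let ?P = "{(g, h) \<in> supp R G f \<times> supp R G f'. g \<otimes>\<^bsub>G\<^esub> h = k}"
  let ?t = "\<lambda>(g, h). twisted_mult R G D \<alpha> w g (f g) h (f' h)"
  have suppG: "supp R G f \<subseteq> carrier G" "supp R G f' \<subseteq> carrier G"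
    by (auto simp: supp_def)
  have t: "?t (g, h) = hmult g (f g) h (f' h)" if "g \<in> carrier G" "h \<in> carrier G" for g h
    using that f f' by (simp add: twisted_mult_eq S_apply_in_D)
  have P: "?P = (\<lambda>g. (g, ?q g)) ` ?B"
  proof (intro equalityI subsetI)
    fix p assume "p \<in> ?P"
    then obtain g h where p: "p = (g, h)" "g \<in> supp R G f" "h \<in> supp R G f'" "g \<otimes>\<^bsub>G\<^esub> h = k"
      by auto
    then have "g \<in> carrier G" "h \<in> carrier G" using suppG by auto
    with p have "h = ?q g" by (metis G.l_inv G.l_one G.inv_closed G.m_assoc)
    with p show "p \<in> (\<lambda>g. (g, ?q g)) ` ?B" by auto
  next
    fix p assume "p \<in> (\<lambda>g. (g, ?q g)) ` ?B"
    then show "p \<in> ?P" using suppG k by (auto simp: G.m_assoc[symmetric])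
  qed
  have "(f \<otimes>\<^bsub>S\<^esub> f') k = finsum R ?t ?P"
    using k by (simp add: crossed_product_def)
  also have "\<dots> = finsum R (\<lambda>g. ?t (g, ?q g)) ?B"
    unfolding P
  proof (rule finsum_reindex)
    show "?t \<in> (\<lambda>g. (g, ?q g)) ` ?B \<rightarrow> carrier R"
    proof
      fix p assume "p \<in> (\<lambda>g. (g, ?q g)) ` ?B"
      then obtain g where g: "p = (g, ?q g)" "g \<in> supp R G f" by auto
      then have gG: "g \<in> carrier G" using suppG by auto
      then have "?t p = hmult g (f g) (?q g) (f' (?q g))" using g k t by simp
      then show "?t p \<in> carrier R" using gG k f f' by simp
    qed
  qed (auto simp: inj_on_def)
  also have "\<dots> = finsum R (\<lambda>g. hmult g (f g) (?q g) (f' (?q g))) A"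
  proof (rule add.finprod_mono_neutral_cong_left)
    show "?B \<subseteq> A" using A by auto
    show "hmult g (f g) (?q g) (f' (?q g)) = \<zero>" if "g \<in> A - ?B" for g
    proof -
      have "g \<in> carrier G" using that A by auto
      moreover from this that k have "f g = \<zero> \<or> f' (?q g) = \<zero>" by (auto simp: supp_def)
      ultimately show ?thesis using k f f' by auto
    qed
    show "?t (g, ?q g) = hmult g (f g) (?q g) (f' (?q g))" if "g \<in> ?B" for g
      using that suppG k t by auto
  qed (use A k f f' in auto)
  finally show ?thesis .
qed

lemma S_add_closed:
  assumes f: "f \<in> carrier S" and f': "f' \<in> carrier S"
  shows "f \<oplus>\<^bsub>S\<^esub> f' \<in> carrier S"
proof -
  have "supp R G (f \<oplus>\<^bsub>S\<^esub> f') \<subseteq> supp R G f \<union> supp R G f'"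
    by (auto simp: supp_def)
  then have "finite (supp R G (f \<oplus>\<^bsub>S\<^esub> f'))"
    using f f' by (auto simp: S_carrier_iff intro: finite_subset)
  moreover have "f \<oplus>\<^bsub>S\<^esub> f' \<in> (\<Pi>\<^sub>E g\<in>carrier G. D g)"
  proof
    show "(f \<oplus>\<^bsub>S\<^esub> f') g \<in> D g" if "g \<in> carrier G" for g
      using that f f' S_apply_in_D by (simp add: D_iff l_distr)
  qed (auto simp: crossed_product_def)
  ultimately show ?thesis by (simp add: S_carrier_iff)
qed

lemma S_mult_closed:
  assumes f: "f \<in> carrier S" and f': "f' \<in> carrier S"
  shows "f \<otimes>\<^bsub>S\<^esub> f' \<in> carrier S"
proof -
  have "(f \<otimes>\<^bsub>S\<^esub> f') k \<in> D k" if k: "k \<in> carrier G" for k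
  proof -
    interpret ideal "D k" R using D_ideal[OF k] .
    have "(f \<otimes>\<^bsub>S\<^esub> f') k
      = (\<Oplus>g\<in>supp R G f. hmult g (f g) (inv\<^bsub>G\<^esub> g \<otimes>\<^bsub>G\<^esub> k) (f' (inv\<^bsub>G\<^esub> g \<otimes>\<^bsub>G\<^esub> k)))"
      by (rule S_mult_apply[OF f f' k supp_finite[OF f]]) (auto simp: supp_def)
    also have "\<dots> \<in> D k"
    proof (rule finsum_closed_ideal, rule Pi_I)
      fix g assume "g \<in> supp R G f"
      then have g: "g \<in> carrier G" by (simp add: supp_def)
      show "hmult g (f g) (inv\<^bsub>G\<^esub> g \<otimes>\<^bsub>G\<^esub> k) (f' (inv\<^bsub>G\<^esub> g \<otimes>\<^bsub>G\<^esub> k)) \<in> D k"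
        using hmult_in_D[of g "inv\<^bsub>G\<^esub> g \<otimes>\<^bsub>G\<^esub> k" "f g" "f' (inv\<^bsub>G\<^esub> g \<otimes>\<^bsub>G\<^esub> k)"] g k f f'
        by (simp add: G.m_assoc[symmetric])
    qed
    finally show ?thesis .
  qed
  then have "f \<otimes>\<^bsub>S\<^esub> f' \<in> (\<Pi>\<^sub>E g\<in>carrier G. D g)"
    by (auto simp: PiE_iff) (simp add: crossed_product_def)
  moreover have "finite (supp R G (f \<otimes>\<^bsub>S\<^esub> f'))"
  proof (rule finite_subset)
    show "supp R G (f \<otimes>\<^bsub>S\<^esub> f') \<subseteq> (\<lambda>(g, h). g \<otimes>\<^bsub>G\<^esub> h) ` (supp R G f \<times> supp R G f')"
      by (rule supp_S_mult)
    show "finite ((\<lambda>(g, h). g \<otimes>\<^bsub>G\<^esub> h) ` (supp R G f \<times> supp R G f'))"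
      using f f' supp_finite by blast
  qed
  ultimately show ?thesis by (simp add: S_carrier_iff)
qed

section \<open>Multiplication by monomials\<close>

lemma monomial_apply [simp]:
  "h \<in> carrier G \<Longrightarrow> monomial R G g a h = (if h = g then a else \<zero>)"
  by (simp add: monomial_def)

lemma supp_monomial: "supp R G (monomial R G g a) \<subseteq> {g}"
  by (auto simp: supp_def split: if_splits)

lemma monomial_closed:
  assumes "g \<in> carrier G" "a \<in> D g"
  shows "monomial R G g a \<in> carrier S"
proof -
  have "monomial R G g a \<in> (\<Pi>\<^sub>E g\<in>carrier G. D g)"
    using assms by (auto simp: PiE_iff zero_in_D) (simp add: monomial_def)
  then show ?thesis
    using finite_subset[OF supp_monomial] by (simp add: S_carrier_iff)
qed

lemma monomial_one_closed: "r \<in> carrier R \<Longrightarrow> monomial R G \<one>\<^bsub>G\<^esub> r \<in> carrier S"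
  by (simp add: monomial_closed D_one)

lemma mult_monomial:
  assumes f: "f \<in> carrier S" and h: "h \<in> carrier G" and b: "b \<in> D h" and k: "k \<in> carrier G"
  shows "(f \<otimes>\<^bsub>S\<^esub> monomial R G h b) k
    = hmult (k \<otimes>\<^bsub>G\<^esub> inv\<^bsub>G\<^esub> h) (f (k \<otimes>\<^bsub>G\<^esub> inv\<^bsub>G\<^esub> h)) h b"
proof -
  let ?m = "monomial R G h b" and ?p = "k \<otimes>\<^bsub>G\<^esub> inv\<^bsub>G\<^esub> h"
  let ?t = "\<lambda>g. hmult g (f g) (inv\<^bsub>G\<^esub> g \<otimes>\<^bsub>G\<^esub> k) (?m (inv\<^bsub>G\<^esub> g \<otimes>\<^bsub>G\<^esub> k))"
  \<comment> \<open>The only index that can contribute is \<open>?p\<close>, which may lie outside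
    the support of \<open>f\<close>; inserting it avoids a case distinction.\<close>
  let ?A = "insert ?p (supp R G f)"
  have m: "?m \<in> carrier S" using h b by (rule monomial_closed)
  have A: "?A \<subseteq> carrier G" using h k by (auto simp: supp_def)
  have p: "inv\<^bsub>G\<^esub> ?p \<otimes>\<^bsub>G\<^esub> k = h"
    using h k by (simp add: G.inv_mult_group G.m_assoc)
  have "(f \<otimes>\<^bsub>S\<^esub> ?m) k = finsum R ?t ?A"
    by (rule S_mult_apply[OF f m k]) (use A f supp_finite in auto)
  also have "\<dots> = finsum R ?t {?p}"
  proof (rule add.finprod_mono_neutral_cong_right)
    fix g assume g: "g \<in> ?A - {?p}"
    then have gG: "g \<in> carrier G" using A by auto
    have "inv\<^bsub>G\<^esub> g \<otimes>\<^bsub>G\<^esub> k \<noteq> h"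
    proof
      assume "inv\<^bsub>G\<^esub> g \<otimes>\<^bsub>G\<^esub> k = h"
      then have "g = ?p" using gG k h by (metis G.inv_solve_left G.inv_solve_right)
      with g show False by simp
    qed
    then show "?t g = \<zero>" using gG k f by simp
  next
    show "?t \<in> ?A \<rightarrow> carrier R"
    proof
      fix g assume "g \<in> ?A"
      then have "g \<in> carrier G" using A by auto
      then show "?t g \<in> carrier R" using f m k by (intro hmult_closed S_apply_closed) auto
    qed
  qed (use f supp_finite in auto)
  also have "\<dots> = ?t ?p"
    using h k f p D_closed[OF h b] by (simp add: finsum_insert)
  finally show ?thesis using p h by simp
qed

lemma monomial_mult:
  assumes f: "f \<in> carrier S" and g: "g \<in> carrier G" and a: "a \<in> D g" and k: "k \<in> carrier G"
  shows "(monomial R G g a \<otimes>\<^bsub>S\<^esub> f) k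
    = hmult g a (inv\<^bsub>G\<^esub> g \<otimes>\<^bsub>G\<^esub> k) (f (inv\<^bsub>G\<^esub> g \<otimes>\<^bsub>G\<^esub> k))"
proof -
  have "a \<in> carrier R" using D_closed g a by blast
  then show ?thesis
    using S_mult_apply[OF monomial_closed[OF g a] f k, of "{g}"] supp_monomial[of g a] g k f
    by (simp add: finsum_insert)
qed

text \<open>Here \<open>w k \<one>\<close> is \<open>u k\<close>, which \<open>\<beta> k r\<close>
  absorbs, so multiplication by elements of \<open>R\<close> acts coefficientwise and cannot enlarge
  supports.\<close>

lemma mult_monomial_one:
  assumes f: "f \<in> carrier S" and r: "r \<in> carrier R" and k: "k \<in> carrier G"
  shows "(f \<otimes>\<^bsub>S\<^esub> monomial R G \<one>\<^bsub>G\<^esub> r) k = f k \<otimes> \<beta> k r"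
proof -
  have "\<beta> k r \<otimes> u k = \<beta> k r" using \<beta>_in_D k r by (simp add: D_iff)
  then show ?thesis
    using assms by (simp add: mult_monomial D_one hmult_def w_one_right m_assoc)
qed

lemma monomial_one_mult:
  assumes f: "f \<in> carrier S" and r: "r \<in> carrier R" and k: "k \<in> carrier G"
  shows "(monomial R G \<one>\<^bsub>G\<^esub> r \<otimes>\<^bsub>S\<^esub> f) k = r \<otimes> f k"
proof -
  have "f k \<otimes> u k = f k" using S_apply_in_D[OF f k] k by (simp add: D_iff)
  then show ?thesis
    using assms by (simp add: monomial_mult D_one hmult_def w_one_left m_assoc)
qed

section \<open>The ring axioms\<close>

text \<open>Both bracketings are brought to the double sum of the terms \<open>T g h\<close> over
  the supports of \<open>x\<close> and \<open>y\<close>; the third group element is then forced by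
  \<open>k\<close>.\<close>

lemma S_mult_assoc:
  assumes x: "x \<in> carrier S" and y: "y \<in> carrier S" and z: "z \<in> carrier S"
  shows "x \<otimes>\<^bsub>S\<^esub> y \<otimes>\<^bsub>S\<^esub> z = x \<otimes>\<^bsub>S\<^esub> (y \<otimes>\<^bsub>S\<^esub> z)"
proof (rule S_eqI)
  fix k assume k: "k \<in> carrier G"
  let ?A = "supp R G x" and ?B = "supp R G y"
  let ?P = "(\<lambda>(g, h). g \<otimes>\<^bsub>G\<^esub> h) ` (?A \<times> ?B)"
  have fin: "finite ?A" "finite ?B" "finite ?P" using x y supp_finite by auto
  have A: "?A \<subseteq> carrier G" and B: "?B \<subseteq> carrier G" by (auto simp: supp_def)
  then have P: "?P \<subseteq> carrier G" by auto
  have suppP: "supp R G (x \<otimes>\<^bsub>S\<^esub> y) \<subseteq> ?P" by (rule supp_S_mult)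
  define T where "T g h = hmult g (x g) (inv\<^bsub>G\<^esub> g \<otimes>\<^bsub>G\<^esub> k)
    (hmult h (y h) (inv\<^bsub>G\<^esub> h \<otimes>\<^bsub>G\<^esub> (inv\<^bsub>G\<^esub> g \<otimes>\<^bsub>G\<^esub> k)) (z (inv\<^bsub>G\<^esub> h \<otimes>\<^bsub>G\<^esub> (inv\<^bsub>G\<^esub> g \<otimes>\<^bsub>G\<^esub> k))))" for g h
  have T_closed: "T g h \<in> carrier R" if "g \<in> carrier G" "h \<in> carrier G" for g h
    using that x y z k by (simp add: T_def)
  have T_zero: "T g h = \<zero>" if "g \<in> carrier G" "h \<in> carrier G" "y h = \<zero>" for g h
    using that x y z k by (simp add: T_def)
  \<comment> \<open>Here \<open>p\<close> stands for the product of the first two group elements, so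
    the second one is \<open>inv g\<close> times \<open>p\<close>.\<close>
  have T_assoc: "hmult p (hmult g (x g) (inv\<^bsub>G\<^esub> g \<otimes>\<^bsub>G\<^esub> p) (y (inv\<^bsub>G\<^esub> g \<otimes>\<^bsub>G\<^esub> p)))
      (inv\<^bsub>G\<^esub> p \<otimes>\<^bsub>G\<^esub> k) (z (inv\<^bsub>G\<^esub> p \<otimes>\<^bsub>G\<^esub> k)) = T g (inv\<^bsub>G\<^esub> g \<otimes>\<^bsub>G\<^esub> p)"
    if g: "g \<in> carrier G" and p: "p \<in> carrier G" for g p
  proof -
    let ?h = "inv\<^bsub>G\<^esub> g \<otimes>\<^bsub>G\<^esub> p" and ?t = "inv\<^bsub>G\<^esub> p \<otimes>\<^bsub>G\<^esub> k"
    have 1: "g \<otimes>\<^bsub>G\<^esub> ?h = p" using g p by (simp add: G.m_assoc[symmetric])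
    have 2: "inv\<^bsub>G\<^esub> ?h \<otimes>\<^bsub>G\<^esub> (inv\<^bsub>G\<^esub> g \<otimes>\<^bsub>G\<^esub> k) = ?t"
    proof -
      have "g \<otimes>\<^bsub>G\<^esub> (inv\<^bsub>G\<^esub> g \<otimes>\<^bsub>G\<^esub> k) = k"
        using g k by (simp add: G.m_assoc[symmetric])
      then show ?thesis using g p k by (simp add: G.inv_mult_group G.m_assoc)
    qed
    have 3: "?h \<otimes>\<^bsub>G\<^esub> ?t = inv\<^bsub>G\<^esub> g \<otimes>\<^bsub>G\<^esub> k"
    proof -
      have "p \<otimes>\<^bsub>G\<^esub> (inv\<^bsub>G\<^esub> p \<otimes>\<^bsub>G\<^esub> k) = k"
        using p k by (simp add: G.m_assoc[symmetric])
      then show ?thesis using g p k by (simp add: G.m_assoc)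
    qed
    show ?thesis
      using hmult_assoc[of g ?h ?t "x g" "y ?h" "z ?t"] g p k x y z
      by (simp only: T_def 1 2 3) simp
  qed
  \<comment> \<open>Substitution of \<open>h\<close> for \<open>inv g\<close> times
    \<open>p\<close>. Since \<open>g\<close> lies in \<open>?A\<close>, every \<open>h\<close> in
    \<open>?B\<close> is reached, from \<open>p = gh\<close>; any other \<open>h\<close> reached has
    \<open>y h = \<zero>\<close>.\<close>
  have inner: "(\<Oplus>p\<in>?P. T g (inv\<^bsub>G\<^esub> g \<otimes>\<^bsub>G\<^esub> p)) = (\<Oplus>h\<in>?B. T g h)" if g: "g \<in> ?A" for g
  proof -
    let ?q = "\<lambda>p. inv\<^bsub>G\<^esub> g \<otimes>\<^bsub>G\<^esub> p"
    have gG: "g \<in> carrier G" using g A by auto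
    have Q: "?q ` ?P \<subseteq> carrier G" using gG P by auto
    have "inj_on ?q ?P"
      using gG P by (intro inj_onI) (metis G.inv_closed G.l_cancel subsetD)
    then have "(\<Oplus>p\<in>?P. T g (?q p)) = (\<Oplus>h\<in>?q ` ?P. T g h)"
      by (intro finsum_reindex[symmetric]) (use Q gG T_closed in auto)
    also have "\<dots> = (\<Oplus>h\<in>?B. T g h)"
    proof (rule add.finprod_mono_neutral_cong_right)
      show "?B \<subseteq> ?q ` ?P"
      proof
        fix h assume h: "h \<in> ?B"
        then have "h = ?q (g \<otimes>\<^bsub>G\<^esub> h)" using B gG by (auto simp: G.m_assoc[symmetric])
        then show "h \<in> ?q ` ?P" using g h by force
      qed
      show "T g h = \<zero>" if "h \<in> ?q ` ?P - ?B" for h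
        using that Q gG T_zero by (auto simp: supp_def)
      show "T g \<in> ?q ` ?P \<rightarrow> carrier R" using Q gG T_closed by auto
    qed (use fin in auto)
    finally show ?thesis .
  qed
  have "(x \<otimes>\<^bsub>S\<^esub> y \<otimes>\<^bsub>S\<^esub> z) k
    = (\<Oplus>p\<in>?P. hmult p ((x \<otimes>\<^bsub>S\<^esub> y) p) (inv\<^bsub>G\<^esub> p \<otimes>\<^bsub>G\<^esub> k) (z (inv\<^bsub>G\<^esub> p \<otimes>\<^bsub>G\<^esub> k)))"
    by (rule S_mult_apply[OF S_mult_closed[OF x y] z k fin(3) suppP P])
  also have "\<dots> = (\<Oplus>p\<in>?P. \<Oplus>g\<in>?A. T g (inv\<^bsub>G\<^esub> g \<otimes>\<^bsub>G\<^esub> p))"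
  proof (rule finsum_cong'[OF refl])
    show "(\<lambda>p. \<Oplus>g\<in>?A. T g (inv\<^bsub>G\<^esub> g \<otimes>\<^bsub>G\<^esub> p)) \<in> ?P \<rightarrow> carrier R"
      using A P T_closed by (intro Pi_I finsum_closed) (auto simp: subset_eq)
    fix p assume "p \<in> ?P"
    then have p: "p \<in> carrier G" using P by auto
    let ?y = "\<lambda>g. hmult g (x g) (inv\<^bsub>G\<^esub> g \<otimes>\<^bsub>G\<^esub> p) (y (inv\<^bsub>G\<^esub> g \<otimes>\<^bsub>G\<^esub> p))"
    have "(x \<otimes>\<^bsub>S\<^esub> y) p = finsum R ?y ?A"
      by (rule S_mult_apply[OF x y p fin(1) order_refl A])
    moreover have "?y \<in> ?A \<rightarrow> carrier R" using A x y p by auto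
    ultimately have "hmult p ((x \<otimes>\<^bsub>S\<^esub> y) p) (inv\<^bsub>G\<^esub> p \<otimes>\<^bsub>G\<^esub> k) (z (inv\<^bsub>G\<^esub> p \<otimes>\<^bsub>G\<^esub> k))
      = (\<Oplus>g\<in>?A. hmult p (?y g) (inv\<^bsub>G\<^esub> p \<otimes>\<^bsub>G\<^esub> k) (z (inv\<^bsub>G\<^esub> p \<otimes>\<^bsub>G\<^esub> k)))"
      using hmult_finsum(1)[OF fin(1), of p "inv\<^bsub>G\<^esub> p \<otimes>\<^bsub>G\<^esub> k" "z (inv\<^bsub>G\<^esub> p \<otimes>\<^bsub>G\<^esub> k)" ?y] p k z by simp
    also have "\<dots> = (\<Oplus>g\<in>?A. T g (inv\<^bsub>G\<^esub> g \<otimes>\<^bsub>G\<^esub> p))"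
      using A p T_closed T_assoc by (intro finsum_cong') auto
    finally show "hmult p ((x \<otimes>\<^bsub>S\<^esub> y) p) (inv\<^bsub>G\<^esub> p \<otimes>\<^bsub>G\<^esub> k) (z (inv\<^bsub>G\<^esub> p \<otimes>\<^bsub>G\<^esub> k))
      = (\<Oplus>g\<in>?A. T g (inv\<^bsub>G\<^esub> g \<otimes>\<^bsub>G\<^esub> p))" .
  qed
  also have "\<dots> = (\<Oplus>g\<in>?A. \<Oplus>p\<in>?P. T g (inv\<^bsub>G\<^esub> g \<otimes>\<^bsub>G\<^esub> p))"
    by (rule finsum_swap) (use A P T_closed in \<open>auto simp: subset_eq\<close>)
  also have "\<dots> = (\<Oplus>g\<in>?A. \<Oplus>h\<in>?B. T g h)"
    by (rule finsum_cong'[OF refl]) (use A B T_closed inner in \<open>auto simp: subset_eq intro!: finsum_closed\<close>)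
  also have "\<dots> = (\<Oplus>g\<in>?A. hmult g (x g) (inv\<^bsub>G\<^esub> g \<otimes>\<^bsub>G\<^esub> k) ((y \<otimes>\<^bsub>S\<^esub> z) (inv\<^bsub>G\<^esub> g \<otimes>\<^bsub>G\<^esub> k)))"
  proof (rule finsum_cong'[OF refl])
    show "(\<lambda>g. hmult g (x g) (inv\<^bsub>G\<^esub> g \<otimes>\<^bsub>G\<^esub> k) ((y \<otimes>\<^bsub>S\<^esub> z) (inv\<^bsub>G\<^esub> g \<otimes>\<^bsub>G\<^esub> k))) \<in> ?A \<rightarrow> carrier R"
      using A x y z k by (auto simp: S_mult_closed)
    fix g assume "g \<in> ?A"
    then have g: "g \<in> carrier G" using A by auto
    let ?l = "inv\<^bsub>G\<^esub> g \<otimes>\<^bsub>G\<^esub> k"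
    let ?z = "\<lambda>h. hmult h (y h) (inv\<^bsub>G\<^esub> h \<otimes>\<^bsub>G\<^esub> ?l) (z (inv\<^bsub>G\<^esub> h \<otimes>\<^bsub>G\<^esub> ?l))"
    have l: "?l \<in> carrier G" using g k by simp
    have "(y \<otimes>\<^bsub>S\<^esub> z) ?l = finsum R ?z ?B"
      by (rule S_mult_apply[OF y z l fin(2) order_refl B])
    moreover have "?z \<in> ?B \<rightarrow> carrier R" using B y z l by auto
    ultimately show "(\<Oplus>h\<in>?B. T g h) = hmult g (x g) ?l ((y \<otimes>\<^bsub>S\<^esub> z) ?l)"
      using hmult_finsum(2)[OF fin(2), of g ?l "x g" ?z] g l x by (simp add: T_def)
  qed
  also have "\<dots> = (x \<otimes>\<^bsub>S\<^esub> (y \<otimes>\<^bsub>S\<^esub> z)) k"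
    by (rule S_mult_apply[OF x S_mult_closed[OF y z] k fin(1) order_refl A, symmetric])
  finally show "(x \<otimes>\<^bsub>S\<^esub> y \<otimes>\<^bsub>S\<^esub> z) k = (x \<otimes>\<^bsub>S\<^esub> (y \<otimes>\<^bsub>S\<^esub> z)) k" .
qed (use x y z S_mult_closed in auto)

lemma S_ring: "ring S"
proof (rule ringI)
  show "abelian_group S"
  proof (rule abelian_groupI)
    fix x assume x: "x \<in> carrier S"
    let ?y = "\<lambda>g\<in>carrier G. \<ominus> x g"
    have "supp R G ?y = supp R G x" using x by (auto simp: supp_def)
    then have y: "?y \<in> carrier S"
      using x S_apply_in_D[OF x] by (auto simp: S_carrier_iff PiE_iff D_iff l_minus)
    then show "\<exists>y\<in>carrier S. y \<oplus>\<^bsub>S\<^esub> x = \<zero>\<^bsub>S\<^esub>"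
      by (rule bexI[rotated]) (rule S_eqI, use x y in \<open>auto simp: S_add_closed S_zero_closed l_neg\<close>)
  qed (auto intro!: S_eqI simp: S_add_closed S_zero_closed a_assoc, auto simp: a_comm)
  show "monoid S"
  proof (rule monoidI)
    show one: "\<one>\<^bsub>S\<^esub> \<in> carrier S" by (simp add: S_one monomial_one_closed)
    fix x assume x: "x \<in> carrier S"
    show "\<one>\<^bsub>S\<^esub> \<otimes>\<^bsub>S\<^esub> x = x"
      by (rule S_eqI) (use x one in \<open>simp_all add: S_mult_closed\<close>, simp add: S_one x monomial_one_mult)
    show "x \<otimes>\<^bsub>S\<^esub> \<one>\<^bsub>S\<^esub> = x"
    proof (rule S_eqI)
      fix g assume g: "g \<in> carrier G"
      then show "(x \<otimes>\<^bsub>S\<^esub> \<one>\<^bsub>S\<^esub>) g = x g"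
        using S_apply_in_D[OF x g] x by (simp add: S_one mult_monomial_one \<beta>_one D_iff)
    qed (use x one S_mult_closed in auto)
  qed (auto simp: S_mult_closed S_mult_assoc)
  fix x y z assume x: "x \<in> carrier S" and y: "y \<in> carrier S" and z: "z \<in> carrier S"
  note xy = S_add_closed[OF x y]
  show "(x \<oplus>\<^bsub>S\<^esub> y) \<otimes>\<^bsub>S\<^esub> z = x \<otimes>\<^bsub>S\<^esub> z \<oplus>\<^bsub>S\<^esub> y \<otimes>\<^bsub>S\<^esub> z"
  proof (rule S_eqI)
    fix k assume k: "k \<in> carrier G"
    \<comment> \<open>Cancellation can make the support of the sum smaller, so all three products
      are expanded over the union.\<close>
    let ?A = "supp R G x \<union> supp R G y"
    have A: "finite ?A" "?A \<subseteq> carrier G" using x y supp_finite by (auto simp: supp_def)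
    have sub: "supp R G x \<subseteq> ?A" "supp R G y \<subseteq> ?A" "supp R G (x \<oplus>\<^bsub>S\<^esub> y) \<subseteq> ?A"
      by (auto simp: supp_def)
    let ?t = "\<lambda>f g. hmult g (f g) (inv\<^bsub>G\<^esub> g \<otimes>\<^bsub>G\<^esub> k) (z (inv\<^bsub>G\<^esub> g \<otimes>\<^bsub>G\<^esub> k))"
    have t: "?t f \<in> ?A \<rightarrow> carrier R" if "f \<in> carrier S" for f
      using that A k z by auto
    have "((x \<oplus>\<^bsub>S\<^esub> y) \<otimes>\<^bsub>S\<^esub> z) k = finsum R (?t (x \<oplus>\<^bsub>S\<^esub> y)) ?A"
      by (rule S_mult_apply[OF xy z k A(1) sub(3) A(2)])
    also have "\<dots> = finsum R (\<lambda>g. ?t x g \<oplus> ?t y g) ?A"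
      by (rule finsum_cong'[OF refl]) (use A x y z k in \<open>auto simp: subset_eq hmult_distr\<close>)
    also have "\<dots> = finsum R (?t x) ?A \<oplus> finsum R (?t y) ?A"
      by (rule finsum_addf[OF t[OF x] t[OF y]])
    also have "\<dots> = (x \<otimes>\<^bsub>S\<^esub> z \<oplus>\<^bsub>S\<^esub> y \<otimes>\<^bsub>S\<^esub> z) k"
      using S_mult_apply[OF x z k A(1) sub(1) A(2)] S_mult_apply[OF y z k A(1) sub(2) A(2)] k by simp
    finally show "((x \<oplus>\<^bsub>S\<^esub> y) \<otimes>\<^bsub>S\<^esub> z) k = (x \<otimes>\<^bsub>S\<^esub> z \<oplus>\<^bsub>S\<^esub> y \<otimes>\<^bsub>S\<^esub> z) k" .
  qed (use x y z S_mult_closed S_add_closed in auto)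
  show "z \<otimes>\<^bsub>S\<^esub> (x \<oplus>\<^bsub>S\<^esub> y) = z \<otimes>\<^bsub>S\<^esub> x \<oplus>\<^bsub>S\<^esub> z \<otimes>\<^bsub>S\<^esub> y"
  proof (rule S_eqI)
    fix k assume k: "k \<in> carrier G"
    let ?A = "supp R G z"
    have A: "finite ?A" "?A \<subseteq> carrier G" using z supp_finite by (auto simp: supp_def)
    let ?t = "\<lambda>f g. hmult g (z g) (inv\<^bsub>G\<^esub> g \<otimes>\<^bsub>G\<^esub> k) (f (inv\<^bsub>G\<^esub> g \<otimes>\<^bsub>G\<^esub> k))"
    have t: "?t f \<in> ?A \<rightarrow> carrier R" if "f \<in> carrier S" for f
      using that A k z by auto
    have "(z \<otimes>\<^bsub>S\<^esub> (x \<oplus>\<^bsub>S\<^esub> y)) k = finsum R (?t (x \<oplus>\<^bsub>S\<^esub> y)) ?A"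
      by (rule S_mult_apply[OF z xy k A(1) order_refl A(2)])
    also have "\<dots> = finsum R (\<lambda>g. ?t x g \<oplus> ?t y g) ?A"
      by (rule finsum_cong'[OF refl]) (use A x y z k in \<open>auto simp: subset_eq hmult_distr\<close>)
    also have "\<dots> = finsum R (?t x) ?A \<oplus> finsum R (?t y) ?A"
      by (rule finsum_addf[OF t[OF x] t[OF y]])
    also have "\<dots> = (z \<otimes>\<^bsub>S\<^esub> x \<oplus>\<^bsub>S\<^esub> z \<otimes>\<^bsub>S\<^esub> y) k"
      using S_mult_apply[OF z x k A(1) order_refl A(2)] S_mult_apply[OF z y k A(1) order_refl A(2)] k
      by simp
    finally show "(z \<otimes>\<^bsub>S\<^esub> (x \<oplus>\<^bsub>S\<^esub> y)) k = (z \<otimes>\<^bsub>S\<^esub> x \<oplus>\<^bsub>S\<^esub> z \<otimes>\<^bsub>S\<^esub> y) k" .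
  qed (use x y z S_mult_closed S_add_closed in auto)
qed

section \<open>The centralizer of the center and elements of minimal support\<close>

abbreviation C :: "('g \<Rightarrow> 'r) set"
  where "C \<equiv> centralizer S (monomial R G \<one>\<^bsub>G\<^esub> ` center R)"

lemma center_closed: "r \<in> center R \<Longrightarrow> r \<in> carrier R"
  by (simp add: center_def centralizer_def)

lemma centralizer_iff:
  "f \<in> C \<longleftrightarrow> f \<in> carrier S \<and> (\<forall>r\<in>center R. \<forall>g\<in>carrier G. f g \<otimes> \<beta> g r = r \<otimes> f g)"
proof -
  have "f \<otimes>\<^bsub>S\<^esub> monomial R G \<one>\<^bsub>G\<^esub> r = monomial R G \<one>\<^bsub>G\<^esub> r \<otimes>\<^bsub>S\<^esub> f \<longleftrightarrow>
      (\<forall>g\<in>carrier G. f g \<otimes> \<beta> g r = r \<otimes> f g)"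
    if f: "f \<in> carrier S" and r: "r \<in> center R" for r
  proof -
    have rR: "r \<in> carrier R" using r by (rule center_closed)
    note m = monomial_one_closed[OF rR]
    show ?thesis
      using f rR S_eqI[OF S_mult_closed[OF f m] S_mult_closed[OF m f]]
      by (metis mult_monomial_one monomial_one_mult)
  qed
  then show ?thesis by (auto simp: centralizer_def)
qed

lemma nonzero_ideal_meets_centralizer:
  assumes I: "ideal I S" and nonzero: "I \<noteq> {\<zero>\<^bsub>S\<^esub>}"
  obtains y where "y \<in> I" "y \<in> C" "y \<noteq> \<zero>\<^bsub>S\<^esub>"
proof -
  interpret S: ring S by (rule S_ring)
  interpret I: ideal I S by (rule I)
  obtain x0 where "x0 \<in> I \<and> x0 \<noteq> \<zero>\<^bsub>S\<^esub>"
    using nonzero I.zero_closed by blast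
  then obtain x where x: "x \<in> I" "x \<noteq> \<zero>\<^bsub>S\<^esub>"
    and min: "\<And>y. \<lbrakk>y \<in> I; y \<noteq> \<zero>\<^bsub>S\<^esub>\<rbrakk> \<Longrightarrow> card (supp R G x) \<le> card (supp R G y)"
    using ex_has_least_nat[of "\<lambda>x. x \<in> I \<and> x \<noteq> \<zero>\<^bsub>S\<^esub>" x0 "\<lambda>x. card (supp R G x)"] by blast
  have xS: "x \<in> carrier S" using x I.Icarr by blast
  then obtain g where "g \<in> supp R G x" using x supp_empty_iff by blast
  then have g: "g \<in> carrier G" "x g \<noteq> \<zero>" by (simp_all add: supp_def)
  let ?i = "inv\<^bsub>G\<^esub> g"
  \<comment> \<open>The coefficient is the identity of \<open>D ?i\<close>, so multiplying by
    \<open>?m\<close> translates the support and changes coefficients only through \<beta> and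
    \<open>w\<close>.\<close>
  let ?m = "monomial R G ?i (u ?i)"
  define y where "y = x \<otimes>\<^bsub>S\<^esub> ?m"
  have mS: "?m \<in> carrier S" using g by (intro monomial_closed u_in_D) simp_all
  have yI: "y \<in> I" unfolding y_def using x(1) mS by (rule I.I_r_closed)
  then have yS: "y \<in> carrier S" by (rule I.Icarr)
  have y_one: "y \<one>\<^bsub>G\<^esub> \<noteq> \<zero>"
  proof
    assume y0: "y \<one>\<^bsub>G\<^esub> = \<zero>"
    have xu: "x g \<otimes> u g = x g" using S_apply_in_D[OF xS g(1)] g(1) by (simp add: D_iff)
    have "y \<one>\<^bsub>G\<^esub> = hmult g (x g) ?i (u ?i)"
      using mult_monomial[OF xS _ u_in_D, of ?i "\<one>\<^bsub>G\<^esub>"] g by (simp add: y_def)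
    also have "\<dots> = x g \<otimes> w g ?i"
      using g xS xu by (simp add: hmult_def \<beta>_u u_one)
    finally have xw: "x g \<otimes> w g ?i = \<zero>" using y0 by simp
    \<comment> \<open>The cancellation leaves \<open>u g \<otimes> u \<one> = u g\<close>, which
      fixes \<open>x g\<close>.\<close>
    have "x g \<otimes> w g ?i \<otimes> w_inv g ?i = \<zero>"
      unfolding xw using g by (intro l_null w_inv(1)) simp_all
    then have "x g = \<zero>"
      using w_inv[of g ?i] g xS xu u_one by (simp add: m_assoc)
    with g show False by simp
  qed
  have "supp R G y \<subseteq> (\<lambda>(g, h). g \<otimes>\<^bsub>G\<^esub> h) ` (supp R G x \<times> {?i})"
    using supp_S_mult[of x ?m] supp_monomial[of ?i "u ?i"] unfolding y_def by blast
  then have "supp R G y \<subseteq> (\<lambda>h. h \<otimes>\<^bsub>G\<^esub> ?i) ` supp R G x" by auto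
  then have "card (supp R G y) \<le> card (supp R G x)"
    using supp_finite[OF xS] by (meson card_image_le card_mono finite_imageI le_trans)
  \<comment> \<open>Translation does not increase the size of the support, so \<open>y\<close>
    inherits the minimality of \<open>x\<close>.\<close>
  then have y_min: "card (supp R G y) \<le> card (supp R G z)" if "z \<in> I" "z \<noteq> \<zero>\<^bsub>S\<^esub>" for z
    using min that le_trans by blast
  have "y g \<otimes> \<beta> g r = r \<otimes> y g" if r: "r \<in> center R" and g: "g \<in> carrier G" for r g
  proof -
    have rR: "r \<in> carrier R" using r by (rule center_closed)
    let ?r = "monomial R G \<one>\<^bsub>G\<^esub> r" and ?s = "monomial R G \<one>\<^bsub>G\<^esub> (\<ominus> r)"
    have rs: "?r \<in> carrier S" "?s \<in> carrier S" using rR by (simp_all add: monomial_one_closed)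
    define z where "z = y \<otimes>\<^bsub>S\<^esub> ?r \<oplus>\<^bsub>S\<^esub> ?s \<otimes>\<^bsub>S\<^esub> y"
    have zI: "z \<in> I"
      unfolding z_def using yI rs by (intro I.a_closed I.I_l_closed I.I_r_closed)
    have z: "z k = y k \<otimes> \<beta> k r \<ominus> r \<otimes> y k" if "k \<in> carrier G" for k
      using that rR yS by (simp add: z_def mult_monomial_one monomial_one_mult l_minus a_minus_def)
    \<comment> \<open>Centrality of \<open>r\<close> enters here: \<beta> at the identity is the
      identity map, so \<open>z\<close> has there the commutator of \<open>y \<one>\<close> and
      \<open>r\<close>.\<close>
    have "r \<otimes> y \<one>\<^bsub>G\<^esub> = y \<one>\<^bsub>G\<^esub> \<otimes> r"
      using r yS by (simp add: center_def centralizer_def)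
    then have "z \<one>\<^bsub>G\<^esub> = \<zero>"
      using z yS rR by (simp add: r_neg a_minus_def)
    moreover have "supp R G z \<subseteq> supp R G y"
      using z rR by (auto simp: supp_def a_minus_def)
    ultimately have "supp R G z \<subset> supp R G y"
      using y_one by (auto simp: supp_def)
    then have "card (supp R G z) < card (supp R G y)"
      using supp_finite[OF yS] by (simp add: psubset_card_mono)
    then have "z = \<zero>\<^bsub>S\<^esub>" using y_min[OF zI] by force
    then have "y g \<otimes> \<beta> g r \<ominus> r \<otimes> y g = \<zero>" using z g by simp
    then show ?thesis using yS rR g by simp
  qed
  then have "y \<in> C" using yS by (simp add: centralizer_iff)
  moreover have "y \<noteq> \<zero>\<^bsub>S\<^esub>" using y_one by auto
  ultimately show ?thesis using that yI by blast
qed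

text \<open>A nonzero ideal \<open>I\<close> meets \<open>C\<close> in a nonzero ideal of
  \<open>C\<close>, hence in all of \<open>C\<close>, and \<open>C\<close> contains the identity of
  \<open>S\<close>.\<close>

lemma simple_if_centralizer_simple:
  assumes "simple_ring (S\<lparr>carrier := C\<rparr>)"
  shows "simple_ring S"
proof -
  interpret S: ring S by (rule S_ring)
  interpret T: simple_ring "S\<lparr>carrier := C\<rparr>" by (rule assms)
  have CS: "C \<subseteq> carrier S" by (auto simp: centralizer_def)
  have zero: "\<zero>\<^bsub>S\<^esub> \<in> C" using T.zero_closed by simp
  have one: "\<one>\<^bsub>S\<^esub> \<in> C" using T.one_closed by simp
  show ?thesis
  proof (unfold_locales)
    show "carrier S \<noteq> {\<zero>\<^bsub>S\<^esub>}"
      using T.nontrivial CS zero by auto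
  next
    fix I assume I: "ideal I S"
    interpret I: ideal I S by (rule I)
    have "I = carrier S" if "I \<noteq> {\<zero>\<^bsub>S\<^esub>}"
    proof -
      have "ideal (I \<inter> C) (S\<lparr>carrier := C\<rparr>)"
      proof (rule idealI)
        show "ring (S\<lparr>carrier := C\<rparr>)" by (rule T.ring_axioms)
        show "subgroup (I \<inter> C) (add_monoid (S\<lparr>carrier := C\<rparr>))"
        proof (rule T.add.subgroupI)
          show "I \<inter> C \<noteq> {}" using I.zero_closed zero by blast
          fix a assume a: "a \<in> I \<inter> C"
          let ?b = "\<ominus>\<^bsub>S\<lparr>carrier := C\<rparr>\<^esub> a"
          have b: "?b \<in> C" "?b \<oplus>\<^bsub>S\<^esub> a = \<zero>\<^bsub>S\<^esub>"
            using a T.a_inv_closed[of a] T.l_neg[of a] by simp_all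
          \<comment> \<open>Negation in the subring refers to its own carrier; uniqueness of
            negatives identifies it with negation in \<open>S\<close>.\<close>
          then have "?b = \<ominus>\<^bsub>S\<^esub> a"
            using a CS S.minus_equality[of ?b a] by auto
          then show "?b \<in> I \<inter> C" using a b by (auto simp: I.a_inv_closed)
        next
          fix a b assume "a \<in> I \<inter> C" "b \<in> I \<inter> C"
          then show "a \<oplus>\<^bsub>S\<lparr>carrier := C\<rparr>\<^esub> b \<in> I \<inter> C"
            using T.a_closed[of a b] I.a_closed[of a b] by simp
        qed auto
        fix a x assume "a \<in> I \<inter> C" and "x \<in> carrier (S\<lparr>carrier := C\<rparr>)"
        then show "x \<otimes>\<^bsub>S\<lparr>carrier := C\<rparr>\<^esub> a \<in> I \<inter> C" "a \<otimes>\<^bsub>S\<lparr>carrier := C\<rparr>\<^esub> x \<in> I \<inter> C"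
          using T.m_closed[of a x] T.m_closed[of x a] I.I_l_closed[of a x] I.I_r_closed[of a x] CS
          by auto
      qed
      then have "I \<inter> C = {\<zero>\<^bsub>S\<^esub>} \<or> I \<inter> C = C"
        using T.ideal_trivial by simp
      moreover have "I \<inter> C \<noteq> {\<zero>\<^bsub>S\<^esub>}"
        using nonzero_ideal_meets_centralizer[OF I \<open>I \<noteq> {\<zero>\<^bsub>S\<^esub>}\<close>] by blast
      ultimately have "\<one>\<^bsub>S\<^esub> \<in> I" using one by blast
      then show "I = carrier S" by (rule I.one_imp_carrier)
    qed
    then show "I = {\<zero>\<^bsub>S\<^esub>} \<or> I = carrier S" by blast
  qed
qed

section \<open>From invariant ideals of \<open>R\<close> to ideals of the crossed product\<close>

text \<open>Each summand \<open>a \<otimes> \<beta> g b \<otimes> w g h\<close> of a product lies in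
  \<open>J\<close> if \<open>a\<close> does, as \<open>J\<close> is an ideal, and also if
  \<open>b\<close> does, as invariance gives closure of \<open>J\<close> under
  \<open>\<beta> g\<close>.\<close>

lemma induced_ideal:
  assumes "\<alpha>_invariant R G D \<alpha> J"
  shows "ideal {f \<in> carrier S. \<forall>g\<in>carrier G. f g \<in> J} S" (is "ideal ?E S")
proof -
  interpret S: ring S by (rule S_ring)
  interpret J: ideal J R using assms by (simp add: \<alpha>_invariant_def)
  have \<beta>_J: "\<beta> g x \<in> J" if "g \<in> carrier G" "x \<in> J" for g x
  proof -
    \<comment> \<open>Invariance speaks only of \<open>J \<inter> D (inv g)\<close>; being an ideal,
      \<open>J\<close> contains the projection of \<open>x\<close> to that part.\<close>
    have "u (inv\<^bsub>G\<^esub> g) \<otimes> x \<in> J \<inter> D (inv\<^bsub>G\<^esub> g)"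
      using that J.Icarr by (simp add: J.I_l_closed u_mult_in_D)
    then show ?thesis
      using assms that(1) unfolding \<alpha>_invariant_def \<beta>_def by blast
  qed
  have mult: "(x \<otimes>\<^bsub>S\<^esub> y) k \<in> J"
    if xy: "x \<in> carrier S" "y \<in> carrier S" "x \<in> ?E \<or> y \<in> ?E" and k: "k \<in> carrier G" for x y k
  proof -
    let ?t = "\<lambda>g. hmult g (x g) (inv\<^bsub>G\<^esub> g \<otimes>\<^bsub>G\<^esub> k) (y (inv\<^bsub>G\<^esub> g \<otimes>\<^bsub>G\<^esub> k))"
    have "(x \<otimes>\<^bsub>S\<^esub> y) k = finsum R ?t (supp R G x)"
      by (rule S_mult_apply[OF xy(1,2) k supp_finite[OF xy(1)]]) (auto simp: supp_def)
    also have "\<dots> \<in> J"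
    proof (rule J.finsum_closed_ideal, rule Pi_I)
      fix g assume "g \<in> supp R G x"
      then have g: "g \<in> carrier G" by (simp add: supp_def)
      let ?h = "inv\<^bsub>G\<^esub> g \<otimes>\<^bsub>G\<^esub> k"
      have h: "?h \<in> carrier G" using g k by simp
      have "x g \<in> J \<or> \<beta> g (y ?h) \<in> J" using xy(3) g h \<beta>_J by auto
      moreover have "x g \<in> carrier R" "\<beta> g (y ?h) \<in> carrier R" using g h xy(1,2) by auto
      ultimately have "x g \<otimes> \<beta> g (y ?h) \<in> J" using J.I_l_closed J.I_r_closed by blast
      then show "?t g \<in> J" unfolding hmult_def using g h by (rule J.I_r_closed[OF _ w_closed])
    qed
    finally show ?thesis .
  qed
  show ?thesis
  proof (rule idealI)
    show "ring S" by (rule S_ring)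
    show "subgroup ?E (add_monoid S)"
    proof (rule S.add.subgroupI)
      show "?E \<noteq> {}" using S.zero_closed J.zero_closed by fastforce
      fix a assume a: "a \<in> ?E"
      have "(\<ominus>\<^bsub>S\<^esub> a) g \<in> J" if g: "g \<in> carrier G" for g
      proof -
        have "(\<ominus>\<^bsub>S\<^esub> a) g \<oplus> a g = \<zero>"
          using a g S.l_neg[of a] S_add_apply[OF g, of "\<ominus>\<^bsub>S\<^esub> a" a] by simp
        then have "(\<ominus>\<^bsub>S\<^esub> a) g = \<ominus> a g"
          using a g by (intro minus_equality[symmetric]) auto
        then show ?thesis using a g by (simp add: J.a_inv_closed)
      qed
      then show "\<ominus>\<^bsub>S\<^esub> a \<in> ?E" using a by simp
    next
      fix a b assume "a \<in> ?E" "b \<in> ?E"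
      then show "a \<oplus>\<^bsub>S\<^esub> b \<in> ?E" by (auto simp: J.a_closed)
    qed auto
    fix a x assume "a \<in> ?E" "x \<in> carrier S"
    then show "x \<otimes>\<^bsub>S\<^esub> a \<in> ?E" "a \<otimes>\<^bsub>S\<^esub> x \<in> ?E"
      using mult[of x a] mult[of a x] by auto
  qed
qed

text \<open>\<open>J\<close> is recovered from its induced ideal by looking at coefficients at the
  identity: a zero induced ideal kills every \<open>monomial\<close> with coefficient in
  \<open>J\<close>, and a full one puts \<open>\<one>\<close> into \<open>J\<close>.\<close>

lemma \<alpha>_simple_if_simple:
  assumes "simple_ring S"
  shows "\<alpha>_simple R G D \<alpha>"
  unfolding \<alpha>_simple_def
proof (intro allI impI)
  fix J assume J: "\<alpha>_invariant R G D \<alpha> J"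
  interpret S: simple_ring S by (rule assms)
  interpret J: ideal J R using J by (simp add: \<alpha>_invariant_def)
  let ?E = "{f \<in> carrier S. \<forall>g\<in>carrier G. f g \<in> J}"
  have mono: "monomial R G \<one>\<^bsub>G\<^esub> r \<in> ?E" if "r \<in> J" for r
    using that J.Icarr J.zero_closed by (auto simp: monomial_one_closed)
  consider "?E = {\<zero>\<^bsub>S\<^esub>}" | "?E = carrier S"
    using S.ideal_trivial[OF induced_ideal[OF J]] by blast
  then show "J = {\<zero>} \<or> J = carrier R"
  proof cases
    case 1
    have "r = \<zero>" if "r \<in> J" for r
    proof -
      have "monomial R G \<one>\<^bsub>G\<^esub> r = \<zero>\<^bsub>S\<^esub>" using mono[OF that] 1 by blast
      then show ?thesis
        using monomial_apply[of "\<one>\<^bsub>G\<^esub>" "\<one>\<^bsub>G\<^esub>" r] by simp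
    qed
    then show ?thesis using J.zero_closed by blast
  next
    case 2
    then have "\<one>\<^bsub>S\<^esub> \<one>\<^bsub>G\<^esub> \<in> J" using S.one_closed by blast
    then have "\<one> \<in> J" by (simp add: S_one)
    then show ?thesis using J.one_imp_carrier by blast
  qed
qed

end

theorem theorem2p21:
  fixes R :: "('r, 'm) ring_scheme" and G :: "('g, 'n) monoid_scheme"
    and D :: "'g \<Rightarrow> 'r set" and u :: "'g \<Rightarrow> 'r"
    and \<alpha> :: "'g \<Rightarrow> 'r \<Rightarrow> 'r" and w :: "'g \<Rightarrow> 'g \<Rightarrow> 'r"
  assumes "unital_twisted_partial_action R G D u \<alpha> w"
    and "simple_ring ((crossed_product R G D \<alpha> w)
      \<lparr>carrier := centralizer (crossed_product R G D \<alpha> w) (monomial R G \<one>\<^bsub>G\<^esub> ` center R)\<rparr>)"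
  shows "simple_ring (crossed_product R G D \<alpha> w) \<longleftrightarrow> \<alpha>_simple R G D \<alpha>"
proof -
  interpret unital_twisted_partial_action R G D u \<alpha> w by (rule assms(1))
  interpret unital_crossed_product R G D u \<alpha> w by unfold_locales
  show ?thesis
    using simple_if_centralizer_simple[OF assms(2)] \<alpha>_simple_if_simple by blast
qed

end
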